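(* Let $\mathfrak M$ be the variety of all metabelian algebras over a field $F$ of characteristic $0$, i.e. the variety defined by the single identity $(xy)(zt)=0$. Then the basic superrank of $\mathfrak M$ is infinite, i.e. $\mathfrak M_{r,s}\neq\tilde{\mathfrak M}$ for all nonnegative integers $r,s$.
   Context: All algebras are over a field $F$ of characteristic $0$ and are not assumed associative or unital. A superalgebra is a $\mathbb Z_2$-graded algebra $\mathcal A=\mathcal A_0+\mathcal A_1$, $\mathcal A_i\mathcal A_j\subseteq\mathcal A_{i+j \bmod 2}$. $\mathrm G=\mathrm G_0+\mathrm G_1$ is the Grassmann algebra on countably many anticommuting generators $e_1,e_2,\dots$ ($\mathrm G_0$, $\mathrm G_1$ spanned by words of even, resp. odd, length). The Grassmann envelope of $\mathcal A$ is $\mathrm G(\mathcal A)=\mathrm G_0\otimes\mathcal A_0+\mathrm G_1\otimes\mathcal A_1\subseteq \mathrm G\otimes\mathcal A$. For a multilinear polynomial $f$, its superization $\tilde f$ is obtained by the Koszul sign rule (a sign $(-1)^{ij}$ whenever a variable of parity $i$ passes through one of parity $j$); $\mathcal A$ satisfies the superidentity $\tilde f=0$ if and only if $\mathrm G(\mathcal A)$ satisfies $f=0$. For a variety $\mathcal V$, a $\mathcal V$-superalgebra is a superalgebra $\mathcal A$ with $\mathrm G(\mathcal A)\in\mathcal V$; $\tilde{\mathcal V}$ is the class of all $\mathcal V$-superalgebras. The supervariety generated by a superalgebra $\mathcal B$ is the class of all superalgebras satisfying every superidentity $\tilde f=0$ ($f$ multilinear) satisfied by $\mathcal B$. For nonnegative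 integers $(r,s)\ne(0,0)$, $\mathcal V_{r,s}$ is the supervariety generated by the free $\mathcal V$-superalgebra on $r$ even and $s$ odd generators; $\mathcal V_{0,0}=\{\{0\}\}$. *)

theory Defs
  imports "HOL-Algebra.QuotRing" "HOL-Algebra.Module" "HOL-Library.Poly_Mapping"
begin

section \<open>Nonassociative algebras and polynomials\<close>

text \<open>The scalars form a field type; \<open>base_field\<close> is that type as a ring record, so that
  vector spaces are the library's modules over it.\<close>

definition base_field :: "'f::field ring" where
  "base_field = \<lparr>carrier = UNIV, mult = (*), one = 1, zero = 0, add = (+)\<rparr>"

text \<open>Algebras are neither associative nor unital: the component \<open>one\<close> of the record carries no
  meaning.\<close>

locale nonassoc_algebra = module base_field A
  for A :: "('f::field, 'a, 'm) module_scheme" (structure) +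
  assumes mult_closed: "x \<in> carrier A \<Longrightarrow> y \<in> carrier A \<Longrightarrow> x \<otimes> y \<in> carrier A"
    and mult_add_left: "x \<in> carrier A \<Longrightarrow> y \<in> carrier A \<Longrightarrow> z \<in> carrier A \<Longrightarrow>
      (x \<oplus> y) \<otimes> z = x \<otimes> z \<oplus> y \<otimes> z"
    and mult_add_right: "x \<in> carrier A \<Longrightarrow> y \<in> carrier A \<Longrightarrow> z \<in> carrier A \<Longrightarrow>
      x \<otimes> (y \<oplus> z) = x \<otimes> y \<oplus> x \<otimes> z"
    and mult_smult_left: "x \<in> carrier A \<Longrightarrow> y \<in> carrier A \<Longrightarrow> (c \<odot> x) \<otimes> y = c \<odot> (x \<otimes> y)"
    and mult_smult_right: "x \<in> carrier A \<Longrightarrow> y \<in> carrier A \<Longrightarrow> x \<otimes> (c \<odot> y) = c \<odot> (x \<otimes> y)"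

datatype 'x monom = Gen 'x | Mul "'x monom" "'x monom"

fun letters :: "'x monom \<Rightarrow> 'x list" where
  "letters (Gen x) = [x]"
| "letters (Mul u v) = letters u @ letters v"

type_synonym ('x, 'f) npoly = "'x monom \<Rightarrow>\<^sub>0 'f"

fun eval_monom :: "('f, 'a, 'm) module_scheme \<Rightarrow> ('x \<Rightarrow> 'a) \<Rightarrow> 'x monom \<Rightarrow> 'a" where
  "eval_monom A a (Gen x) = a x"
| "eval_monom A a (Mul u v) = eval_monom A a u \<otimes>\<^bsub>A\<^esub> eval_monom A a v"

definition eval_poly ::
    "('f::field, 'a, 'm) module_scheme \<Rightarrow> ('x \<Rightarrow> 'a) \<Rightarrow> ('x, 'f) npoly \<Rightarrow> 'a" where
  "eval_poly A a f =
    (\<Oplus>\<^bsub>A\<^esub>m\<in>Poly_Mapping.keys f. Poly_Mapping.lookup f m \<odot>\<^bsub>A\<^esub> eval_monom A a m)"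

definition satisfies :: "('f::field, 'a, 'm) module_scheme \<Rightarrow> (nat, 'f) npoly \<Rightarrow> bool" where
  "satisfies A f \<longleftrightarrow> (\<forall>a. (\<forall>i. a i \<in> carrier A) \<longrightarrow> eval_poly A a f = \<zero>\<^bsub>A\<^esub>)"

text \<open>A variety is given by a set of defining identities; \<open>variety\<close> is the class of algebras it
  consists of, for every type \<open>'a\<close> of carriers.\<close>

definition variety :: "(nat, 'f::field) npoly set \<Rightarrow> ('f, 'a) module set" where
  "variety I = {A. nonassoc_algebra A \<and> (\<forall>f\<in>I. satisfies A f)}"

definition metabelian :: "(nat, 'f::field) npoly set" where
  "metabelian =
    {Poly_Mapping.single (Mul (Mul (Gen 0) (Gen 1)) (Mul (Gen 2) (Gen 3))) 1}"


section \<open>Superalgebras and the Grassmann envelope\<close>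

text \<open>Parities are Booleans; \<open>part A False\<close> is the even and \<open>part A True\<close> the odd component, and
  addition modulo 2 is \<open>\<noteq>\<close>.\<close>

record ('f, 'a) superalg = "('f, 'a) module" +
  part :: "bool \<Rightarrow> 'a set"

locale superalgebra = nonassoc_algebra A
  for A :: "('f::field, 'a, 'm) superalg_scheme" (structure) +
  assumes part_submodule: "submodule (part A i) base_field A"
    and part_sum: "x \<in> carrier A \<Longrightarrow> \<exists>y\<in>part A False. \<exists>z\<in>part A True. x = y \<oplus> z"
    and part_Int: "part A False \<inter> part A True = {\<zero>}"
    and part_mult: "x \<in> part A i \<Longrightarrow> y \<in> part A j \<Longrightarrow> x \<otimes> y \<in> part A (i \<noteq> j)"

text \<open>The Grassmann algebra has the basis of the words \<open>e\<^sub>S\<close>, the product of the \<open>e\<^sub>k\<close> with \<open>k \<in> S\<close>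
  in increasing order, for \<open>S\<close> a finite set of naturals; \<open>e\<^sub>S e\<^sub>T\<close> is \<open>grassmann_sign S T\<close> times
  \<open>e\<^bsub>S \<union> T\<^esub>\<close> if \<open>S\<close> and \<open>T\<close> are disjoint, and \<open>0\<close> otherwise.\<close>

definition grassmann_sign :: "nat set \<Rightarrow> nat set \<Rightarrow> 'f::field" where
  "grassmann_sign S T = (- 1) ^ card {(s, t). s \<in> S \<and> t \<in> T \<and> t < s}"

text \<open>The finitely supported function \<open>u\<close> stands for the element \<open>\<Sum>\<^sub>S e\<^sub>S \<otimes> u S\<close> of the tensor
  product of the Grassmann algebra with \<open>A\<close>.\<close>

definition grassmann_envelope ::
    "('f::field, 'a, 'm) superalg_scheme \<Rightarrow> ('f, nat set \<Rightarrow> 'a) module" where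
  "grassmann_envelope A =
    \<lparr>carrier = {u. finite {S. u S \<noteq> \<zero>\<^bsub>A\<^esub>} \<and> (\<forall>S. u S \<noteq> \<zero>\<^bsub>A\<^esub> \<longrightarrow> finite S) \<and>
        (\<forall>S. u S \<in> part A (odd (card S)))},
     mult = (\<lambda>u v S. if finite S
        then \<Oplus>\<^bsub>A\<^esub>T\<in>Pow S. grassmann_sign T (S - T) \<odot>\<^bsub>A\<^esub> (u T \<otimes>\<^bsub>A\<^esub> v (S - T)) else \<zero>\<^bsub>A\<^esub>),
     one = undefined,
     zero = (\<lambda>S. \<zero>\<^bsub>A\<^esub>),
     add = (\<lambda>u v S. u S \<oplus>\<^bsub>A\<^esub> v S),
     smult = (\<lambda>c u S. c \<odot>\<^bsub>A\<^esub> u S)\<rparr>"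

text \<open>The class of \<open>V\<close>-superalgebras, for the variety \<open>V\<close> defined by \<open>I\<close>.\<close>

definition super_class :: "(nat, 'f::field) npoly set \<Rightarrow> ('f, 'a) superalg set" where
  "super_class I = {A. superalgebra A \<and> grassmann_envelope A \<in> variety I}"


section \<open>Superidentities\<close>

definition multilinear :: "(nat, 'f::zero) npoly \<Rightarrow> bool" where
  "multilinear f \<longleftrightarrow>
    (\<exists>X. \<forall>m\<in>Poly_Mapping.keys f. distinct (letters m) \<and> set (letters m) = X)"

text \<open>The sign of rearranging the variables of a word into increasing order: only the inversions
  between two odd variables contribute.\<close>

definition koszul_sign :: "(nat \<Rightarrow> bool) \<Rightarrow> nat list \<Rightarrow> 'f::field" where
  "koszul_sign p w =
    (- 1) ^ card {(i, j). i < j \<and> j < length w \<and> w ! j < w ! i \<and> p (w ! i) \<and> p (w ! j)}"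

definition superization ::
    "(nat \<Rightarrow> bool) \<Rightarrow> (nat, 'f::field) npoly \<Rightarrow> (nat, 'f) npoly" where
  "superization p f = Poly_Mapping.mapp (\<lambda>m c. koszul_sign p (letters m) * c) f"

definition satisfies_super ::
    "('f::field, 'a, 'm) superalg_scheme \<Rightarrow> (nat, 'f) npoly \<Rightarrow> bool" where
  "satisfies_super A f \<longleftrightarrow>
    (\<forall>p a. (\<forall>i. a i \<in> part A (p i)) \<longrightarrow> eval_poly A a (superization p f) = \<zero>\<^bsub>A\<^esub>)"

definition generated_supervariety ::
    "('f::field, 'b) superalg \<Rightarrow> ('f, 'a) superalg set" where
  "generated_supervariety B = {A. superalgebra A \<and>
    (\<forall>f. multilinear f \<longrightarrow> satisfies_super B f \<longrightarrow> satisfies_super A f)}"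


section \<open>Free superalgebras\<close>

text \<open>The even generators are \<open>Inl i\<close> with \<open>i < r\<close>, the odd ones \<open>Inr j\<close> with \<open>j < s\<close>.\<close>

definition generators :: "nat \<Rightarrow> nat \<Rightarrow> (nat + nat) set" where
  "generators r s = Inl ` {..<r} \<union> Inr ` {..<s}"

definition monom_parity :: "(nat + nat) monom \<Rightarrow> bool" where
  "monom_parity m = odd (length (filter (\<lambda>x. \<not> isl x) (letters m)))"

definition free_superalgebra ::
    "nat \<Rightarrow> nat \<Rightarrow> ('f::field, (nat + nat, 'f) npoly) superalg" where
  "free_superalgebra r s =
    (let C = {f. \<forall>m\<in>Poly_Mapping.keys f. set (letters m) \<subseteq> generators r s} in
     \<lparr>carrier = C,
      mult = (\<lambda>f g. \<Sum>u\<in>Poly_Mapping.keys f. \<Sum>v\<in>Poly_Mapping.keys g.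
        Poly_Mapping.single (Mul u v) (Poly_Mapping.lookup f u * Poly_Mapping.lookup g v)),
      one = undefined,
      zero = 0,
      add = (+),
      smult = (\<lambda>c. Poly_Mapping.map ((*) c)),
      part = (\<lambda>i. {f \<in> C. \<forall>m\<in>Poly_Mapping.keys f. monom_parity m = i})\<rparr>)"

definition graded_ideal :: "('f::field, 'a, 'm) superalg_scheme \<Rightarrow> 'a set \<Rightarrow> bool" where
  "graded_ideal A J \<longleftrightarrow> submodule J base_field A \<and>
    (\<forall>a\<in>carrier A. \<forall>x\<in>J. a \<otimes>\<^bsub>A\<^esub> x \<in> J \<and> x \<otimes>\<^bsub>A\<^esub> a \<in> J) \<and>
    (\<forall>x\<in>J. \<exists>y\<in>J \<inter> part A False. \<exists>z\<in>J \<inter> part A True. x = y \<oplus>\<^bsub>A\<^esub> z)"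

definition quotient_superalgebra ::
    "('f::field, 'a) superalg \<Rightarrow> 'a set \<Rightarrow> ('f, 'a set) superalg" where
  "quotient_superalgebra A J =
    \<lparr>carrier = a_rcosets\<^bsub>A\<^esub> J,
     mult = rcoset_mult A J,
     one = undefined,
     zero = J,
     add = set_add A,
     smult = (\<lambda>c X. \<Union>x\<in>X. J +>\<^bsub>A\<^esub> (c \<odot>\<^bsub>A\<^esub> x)),
     part = (\<lambda>i. (\<lambda>x. J +>\<^bsub>A\<^esub> x) ` part A i)\<rparr>"

text \<open>The free \<open>V\<close>-superalgebra is the largest quotient of the absolutely free superalgebra that is
  a \<open>V\<close>-superalgebra. The intersection below is over a nonempty family (the whole algebra belongs
  to it) and is itself a member, because \<open>V\<close>-superalgebras are closed under subdirect products;
  every graded homomorphism from the absolutely free superalgebra to a \<open>V\<close>-superalgebra factors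
  through the quotient, since its kernel belongs to the family.\<close>

definition free_super_ideal ::
    "(nat, 'f::field) npoly set \<Rightarrow> nat \<Rightarrow> nat \<Rightarrow> (nat + nat, 'f) npoly set" where
  "free_super_ideal I r s = \<Inter> {J. graded_ideal (free_superalgebra r s) J \<and>
    quotient_superalgebra (free_superalgebra r s) J \<in> super_class I}"

definition free_V_superalgebra ::
    "(nat, 'f::field) npoly set \<Rightarrow> nat \<Rightarrow> nat \<Rightarrow> ('f, (nat + nat, 'f) npoly set) superalg" where
  "free_V_superalgebra I r s =
    quotient_superalgebra (free_superalgebra r s) (free_super_ideal I r s)"

definition supervariety_rs ::
    "(nat, 'f::field) npoly set \<Rightarrow> nat \<Rightarrow> nat \<Rightarrow> ('f, 'a) superalg set" where
  "supervariety_rs I r s =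
    (if r = 0 \<and> s = 0 then {A. superalgebra A \<and> carrier A = {\<zero>\<^bsub>A\<^esub>}}
     else generated_supervariety (free_V_superalgebra I r s))"

text \<open>HOL has no class of all superalgebras, so classes of superalgebras are compared on a fixed
  type of carriers: the one of the free \<open>V\<close>-superalgebras. Every countably generated superalgebra
  has an isomorphic copy with carrier in this type, and membership in the classes above depends
  only on the countably generated sub-superalgebras.\<close>

type_synonym 'f universe = "(nat + nat, 'f) npoly set"

end

theory Submission
  imports Complex_Main "HOL-Combinatorics.Multiset_Permutations" Defs
begin

text \<open>For given \<open>r\<close> and \<open>s\<close>, some multilinear polynomial is a superidentity of the free metabelian
  superalgebra on \<open>r\<close> even and \<open>s\<close> odd generators but not of all metabelian superalgebras.

  The polynomials in question are combinations, with coefficients \<open>c w\<close>, of the left-normed monomials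
  that multiply the product of two fixed variables successively from the right by \<open>N\<close> further
  variables, in the order prescribed by the permutation \<open>w\<close>. In a metabelian superalgebra products
  annihilate each other, so in such a monomial only the values of the \<open>N\<close> variables modulo products
  matter. In the free metabelian superalgebra these are linear combinations of the \<open>d = r + s\<close>
  generators. By multilinearity, the polynomial vanishes as soon as, for each choice of parities,
  each substitution of generators for the \<open>N\<close> variables and each resulting word in the generators,
  the sum of the signed coefficients of the permutations that produce this word is zero. These are
  at most \<open>2 ^ (N + 2) * d ^ (2 * N)\<close> homogeneous linear equations for \<open>fact N\<close> unknowns. The factorial
  outgrows the exponential, hence a nonzero solution exists for some \<open>N\<close>
  (\<open>cancelling_coefficients\<close>), and its polynomial is a superidentity of the free metabelian
  superalgebra (\<open>free_metabelian_superalgebra_satisfies\<close>).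

  On the other hand, dividing the free algebra on \<open>N + 2\<close> even generators by the span of the
  monomials that are not left-normed gives a metabelian superalgebra in which the left-normed
  monomials are linearly independent; there the polynomial takes a nonzero value
  (\<open>left_normed_superalgebra_violates\<close>). For \<open>r = s = 0\<close> it is enough that a quotient of this kind is
  nonzero.

  To connect this with the definitions, one needs that the Grassmann envelope of a superalgebra is
  metabelian exactly if the superalgebra is (\<open>super_class_metabelian_iff\<close>), and that quotients of
  superalgebras by graded ideals are superalgebras, to which evaluation of polynomials descends.\<close>

section \<open>The absolutely free superalgebra\<close>

lemma base_field_simps [simp]:
  "carrier base_field = UNIV" "mult base_field = (*)" "one base_field = 1"
  "zero base_field = 0" "add base_field = (+)"
  by (simp_all add: base_field_def)

lemma cring_base_field: "cring (base_field :: 'f::field ring)"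
proof (rule cringI)
  show "abelian_group (base_field :: 'f ring)"
  proof (rule abelian_groupI)
    fix x :: 'f
    show "\<exists>y\<in>carrier base_field. y \<oplus>\<^bsub>base_field\<^esub> x = \<zero>\<^bsub>base_field\<^esub>"
      by (rule bexI[of _ "- x"]) simp_all
  qed (simp_all add: algebra_simps)
  show "comm_monoid (base_field :: 'f ring)"
    by (rule comm_monoidI) (simp_all add: algebra_simps)
qed (simp_all add: algebra_simps)

lemma free_superalgebra_simps:
  "carrier (free_superalgebra r s) = {f. \<forall>m\<in>Poly_Mapping.keys f. set (letters m) \<subseteq> generators r s}"
  "zero (free_superalgebra r s) = 0"
  "add (free_superalgebra r s) = (+)"
  "smult (free_superalgebra r s) = (\<lambda>c. Poly_Mapping.map ((*) c))"
  "part (free_superalgebra r s) i =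
    {f \<in> carrier (free_superalgebra r s). \<forall>m\<in>Poly_Mapping.keys f. monom_parity m = i}"
  by (simp_all add: free_superalgebra_def)

lemma lookup_smult:
  fixes f :: "'x \<Rightarrow>\<^sub>0 'f::field"
  shows "Poly_Mapping.lookup (Poly_Mapping.map ((*) c) f) m = c * Poly_Mapping.lookup f m"
  by (simp add: Poly_Mapping.map.rep_eq when_def)

text \<open>A nonassociative monomial factors in at most one way, so a coefficient of a product is a single
  product of coefficients. This reduces most computations in the free superalgebra to a comparison
  of coefficients.\<close>

lemma lookup_free_mult:
  fixes f g :: "(nat + nat, 'f::field) npoly"
  shows "Poly_Mapping.lookup (f \<otimes>\<^bsub>free_superalgebra r s\<^esub> g) m =
    (case m of Gen x \<Rightarrow> 0 | Mul u v \<Rightarrow> Poly_Mapping.lookup f u * Poly_Mapping.lookup g v)"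
proof -
  have eq: "Poly_Mapping.lookup (f \<otimes>\<^bsub>free_superalgebra r s\<^esub> g) m =
    (\<Sum>u\<in>Poly_Mapping.keys f. \<Sum>v\<in>Poly_Mapping.keys g.
      (Poly_Mapping.lookup f u * Poly_Mapping.lookup g v when Mul u v = m))"
    by (simp add: free_superalgebra_def lookup_sum lookup_single)
  show ?thesis
  proof (cases m)
    case (Gen x)
    then show ?thesis using eq by simp
  next
    case (Mul a b)
    have "(\<Sum>u\<in>Poly_Mapping.keys f. \<Sum>v\<in>Poly_Mapping.keys g.
        (Poly_Mapping.lookup f u * Poly_Mapping.lookup g v when Mul u v = m)) =
      (\<Sum>u\<in>Poly_Mapping.keys f. if u = a then
        (\<Sum>v\<in>Poly_Mapping.keys g. if v = b then Poly_Mapping.lookup f a * Poly_Mapping.lookup g b else 0) else 0)"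
      unfolding Mul by (intro sum.cong) (auto simp: when_def)
    also have "\<dots> = Poly_Mapping.lookup f a * Poly_Mapping.lookup g b"
      by (auto simp: sum.delta in_keys_iff)
    finally show ?thesis using eq Mul by simp
  qed
qed

lemma mem_free_iff:
  "f \<in> carrier (free_superalgebra r s) \<longleftrightarrow>
    (\<forall>m. Poly_Mapping.lookup f m \<noteq> 0 \<longrightarrow> set (letters m) \<subseteq> generators r s)"
  by (auto simp: free_superalgebra_simps in_keys_iff)

lemma mem_free_part_iff:
  "f \<in> part (free_superalgebra r s) i \<longleftrightarrow> f \<in> carrier (free_superalgebra r s) \<and>
    (\<forall>m. Poly_Mapping.lookup f m \<noteq> 0 \<longrightarrow> monom_parity m = i)"
  by (auto simp: free_superalgebra_simps in_keys_iff)

lemma monom_parity_Mul [simp]: "monom_parity (Mul u v) = (monom_parity u \<noteq> monom_parity v)"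
  by (auto simp: monom_parity_def)

definition homogeneous_part :: "bool \<Rightarrow> (nat + nat, 'f::field) npoly \<Rightarrow> (nat + nat, 'f) npoly" where
  "homogeneous_part i f = Poly_Mapping.mapp (\<lambda>m c. if monom_parity m = i then c else 0) f"

lemma lookup_homogeneous_part:
  "Poly_Mapping.lookup (homogeneous_part i f) m =
    (if monom_parity m = i then Poly_Mapping.lookup f m else 0)"
  by (auto simp: homogeneous_part_def lookup_mapp when_def in_keys_iff)

lemma homogeneous_part_sum: "f = homogeneous_part False f + homogeneous_part True f"
  by (rule poly_mapping_eqI) (simp add: lookup_add lookup_homogeneous_part)

lemma homogeneous_part_in_part:
  assumes "f \<in> carrier (free_superalgebra r s)"
  shows "homogeneous_part i f \<in> part (free_superalgebra r s) i"
  using assms by (auto simp: mem_free_part_iff mem_free_iff lookup_homogeneous_part)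

lemma module_free_superalgebra:
  "module base_field (free_superalgebra r s :: ('f::field, (nat + nat, 'f) npoly) superalg)"
    (is "module _ ?F")
proof (rule moduleI[OF cring_base_field])
  show "abelian_group ?F"
  proof (rule abelian_groupI)
    fix x assume "x \<in> carrier ?F"
    then show "\<exists>y\<in>carrier ?F. y \<oplus>\<^bsub>?F\<^esub> x = \<zero>\<^bsub>?F\<^esub>"
      by (intro bexI[of _ "- x"]) (auto simp: mem_free_iff free_superalgebra_simps(2,3))
  next
    fix x y assume "x \<in> carrier ?F" "y \<in> carrier ?F"
    then show "x \<oplus>\<^bsub>?F\<^esub> y \<in> carrier ?F"
      by (simp add: mem_free_iff free_superalgebra_simps(3) lookup_add) (metis add_0)
  qed (simp_all add: free_superalgebra_simps(2,3) mem_free_iff ac_simps)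
next
  fix c d :: 'f and x y :: "(nat + nat, 'f) npoly"
  assume x: "x \<in> carrier ?F" and y: "y \<in> carrier ?F"
  show "c \<odot>\<^bsub>?F\<^esub> x \<in> carrier ?F"
    using x by (auto simp: mem_free_iff free_superalgebra_simps(4) lookup_smult)
qed (auto intro!: poly_mapping_eqI
  simp: free_superalgebra_simps(3,4) lookup_smult lookup_add algebra_simps)

lemma superalgebra_free_superalgebra:
  "superalgebra (free_superalgebra r s :: ('f::field, (nat + nat, 'f) npoly) superalg)"
    (is "superalgebra ?F")
proof -
  interpret module base_field ?F
    by (rule module_free_superalgebra)
  note S = free_superalgebra_simps(2-4)
  have na: "nonassoc_algebra ?F"
  proof (intro nonassoc_algebra.intro module_free_superalgebra nonassoc_algebra_axioms.intro)
    fix x y assume "x \<in> carrier ?F" "y \<in> carrier ?F"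
    then show "x \<otimes>\<^bsub>?F\<^esub> y \<in> carrier ?F"
      by (auto simp: mem_free_iff lookup_free_mult split: monom.splits) 
  qed (auto intro!: poly_mapping_eqI
      simp: S lookup_smult lookup_add lookup_free_mult algebra_simps split: monom.splits)
  show ?thesis
  proof (intro superalgebra.intro na superalgebra_axioms.intro)
    fix i
    show "submodule (part ?F i) base_field ?F"
    proof (rule submoduleI)
      fix a assume a: "a \<in> part ?F i"
      then have "a \<in> carrier ?F" by (simp add: mem_free_part_iff)
      then have "\<ominus>\<^bsub>?F\<^esub> a = - a"
        by (intro minus_equality) (auto simp: S mem_free_iff)
      with a show "\<ominus>\<^bsub>?F\<^esub> a \<in> part ?F i"
        by (auto simp: mem_free_part_iff mem_free_iff)
    next
      fix a b assume "a \<in> part ?F i" "b \<in> part ?F i"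
      then show "a \<oplus>\<^bsub>?F\<^esub> b \<in> part ?F i"
        by (simp add: mem_free_part_iff mem_free_iff S lookup_add) (metis add_0)
    qed (auto simp: mem_free_part_iff mem_free_iff S lookup_smult)
  next
    fix x assume "x \<in> carrier ?F"
    then show "\<exists>y\<in>part ?F False. \<exists>z\<in>part ?F True. x = y \<oplus>\<^bsub>?F\<^esub> z"
      using homogeneous_part_sum homogeneous_part_in_part unfolding S by blast
  next
    show "part ?F False \<inter> part ?F True = {\<zero>\<^bsub>?F\<^esub>}"
      by (auto simp: mem_free_part_iff mem_free_iff S intro!: poly_mapping_eqI)
  next
    fix x i y j assume "x \<in> part ?F i" "y \<in> part ?F j"
    then show "x \<otimes>\<^bsub>?F\<^esub> y \<in> part ?F (i \<noteq> j)"
      by (auto simp: mem_free_part_iff mem_free_iff lookup_free_mult split: monom.splits)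
  qed
qed

section \<open>Homomorphic images and quotients\<close>

locale algebra_hom = A?: nonassoc_algebra A
  for A :: "('f::field, 'a, 'm) module_scheme" (structure)
    and B :: "('f, 'b, 'n) module_scheme" and h +
  assumes hom_mem: "x \<in> carrier A \<Longrightarrow> h x \<in> carrier B"
    and hom_zero: "h \<zero> = \<zero>\<^bsub>B\<^esub>"
    and hom_add: "x \<in> carrier A \<Longrightarrow> y \<in> carrier A \<Longrightarrow> h (x \<oplus> y) = h x \<oplus>\<^bsub>B\<^esub> h y"
    and hom_smult: "x \<in> carrier A \<Longrightarrow> h (c \<odot> x) = c \<odot>\<^bsub>B\<^esub> h x"
    and hom_mult: "x \<in> carrier A \<Longrightarrow> y \<in> carrier A \<Longrightarrow> h (x \<otimes> y) = h x \<otimes>\<^bsub>B\<^esub> h y"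
begin

lemma surjective_image_nonassoc_algebra:
  assumes surj: "carrier B = h ` carrier A"
  shows "nonassoc_algebra B"
proof -
  have "abelian_group B"
  proof (rule abelian_groupI)
    fix x assume "x \<in> carrier B"
    then obtain a where "a \<in> carrier A" "x = h a" by (auto simp: surj)
    then show "\<exists>y\<in>carrier B. y \<oplus>\<^bsub>B\<^esub> x = \<zero>\<^bsub>B\<^esub>"
      by (intro bexI[of _ "h (\<ominus> a)"])
        (simp_all add: surj hom_zero A.M.l_neg flip: hom_add)
  qed (auto simp: surj simp flip: hom_add hom_zero intro!: A.M.a_assoc A.M.a_comm imageI arg_cong[of _ _ h])
  then have "module base_field B"
    by (intro moduleI[OF cring_base_field])
      (auto simp: surj A.smult_l_distr A.smult_r_distr A.smult_assoc1[simplified]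
        A.smult_l_distr[simplified] A.smult_one[simplified]
        simp flip: hom_add hom_smult)
  then show ?thesis
    by (intro nonassoc_algebra.intro nonassoc_algebra_axioms.intro)
      (auto simp: surj A.mult_closed A.mult_add_left A.mult_add_right A.mult_smult_left
        A.mult_smult_right simp flip: hom_add hom_smult hom_mult)
qed

lemma hom_eval_monom:
  assumes "\<And>i. a i \<in> carrier A"
  shows "eval_monom A a m \<in> carrier A \<and> eval_monom B (\<lambda>i. h (a i)) m = h (eval_monom A a m)"
  by (induction m) (auto simp: assms A.mult_closed hom_mult)

lemma hom_eval_poly:
  assumes "nonassoc_algebra B" and a: "\<And>i. a i \<in> carrier A"
  shows "eval_poly B (\<lambda>i. h (a i)) f = h (eval_poly A a f)"
proof -
  interpret B: nonassoc_algebra B by fact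
  have fin: "(\<Oplus>\<^bsub>B\<^esub>k\<in>K. h (g k)) = h (\<Oplus>k\<in>K. g k)"
    if "finite K" "\<And>k. g k \<in> carrier A" for g :: "'c monom \<Rightarrow> 'a" and K
    using that(1)
    by induction (use that(2) in \<open>simp_all add: hom_zero hom_add hom_mem A.M.finsum_closed\<close>)
  show ?thesis
    using hom_eval_monom[where a = a, OF a] unfolding eval_poly_def
    by (simp add: hom_smult flip: fin[where g = "\<lambda>m. Poly_Mapping.lookup f m \<odot> eval_monom A a m"])
qed

end

lemma (in superalgebra) part_subset: "part A i \<subseteq> carrier A"
  using submoduleE(1)[OF part_submodule] .

lemma (in superalgebra) zero_in_part: "\<zero> \<in> part A i"
  using part_Int by (cases i) auto

lemma (in superalgebra) homogeneous_components_unique: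
  assumes "a \<in> part A False" "b \<in> part A True" "a' \<in> part A False" "b' \<in> part A True"
    and "a \<oplus> b = a' \<oplus> b'"
  shows "a = a'" "b = b'"
proof -
  have car: "a \<in> carrier A" "b \<in> carrier A" "a' \<in> carrier A" "b' \<in> carrier A"
    using assms part_subset by blast+
  have "a \<ominus> a' = (a \<oplus> b) \<ominus> b \<ominus> a'"
    using car by (simp add: a_minus_def a_assoc r_neg)
  also have "\<dots> = b' \<ominus> b"
    unfolding assms(5) using car by (simp add: a_minus_def a_assoc) (simp add: a_lcomm[of a'] r_neg)
  finally have eq: "a \<ominus> a' = b' \<ominus> b" .
  have "a \<ominus> a' \<in> part A False"
    unfolding a_minus_def using assms submoduleE(3,5)[OF part_submodule] by blast
  moreover have "b' \<ominus> b \<in> part A True"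
    unfolding a_minus_def using assms submoduleE(3,5)[OF part_submodule] by blast
  ultimately have "a \<ominus> a' = \<zero>" "b' \<ominus> b = \<zero>"
    using part_Int eq by auto
  then show "a = a'" "b = b'"
    using car M.minus_equality[of a "\<ominus> a'"] M.minus_equality[of b' "\<ominus> b"]
    by (simp_all add: a_minus_def)
qed

locale graded_quotient = superalgebra A
  for A :: "('f::field, 'a) superalg" (structure) +
  fixes J
  assumes graded_ideal: "graded_ideal A J"
begin

lemma ideal_submodule: "submodule J base_field A"
  using graded_ideal by (simp add: graded_ideal_def)

lemma ideal_mult:
  assumes "a \<in> carrier A" "x \<in> J"
  shows "a \<otimes> x \<in> J" "x \<otimes> a \<in> J"
  using graded_ideal assms by (auto simp: graded_ideal_def)

lemmas ideal_subset = submoduleE(1)[OF ideal_submodule]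
  and ideal_smult = submoduleE(4)[OF ideal_submodule, simplified]
  and ideal_add = submoduleE(5)[OF ideal_submodule]

sublocale J: abelian_subgroup J A
  by (intro abelian_subgroupI3 additive_subgroup.intro submodule.axioms(1)[OF ideal_submodule]
      abelian_group_axioms)

lemma mem_coset_iff: "y \<in> J +> x \<longleftrightarrow> (\<exists>j\<in>J. y = j \<oplus> x)"
  by (auto simp: a_r_coset_def')

lemma coset_eq_iff:
  assumes "x \<in> carrier A" "y \<in> carrier A"
  shows "J +> x = J +> y \<longleftrightarrow> x \<ominus> y \<in> J"
proof
  assume "J +> x = J +> y"
  then have "x \<in> J +> y" using J.a_rcos_self assms by blast
  then show "x \<ominus> y \<in> J"
    unfolding a_minus_def using assms J.a_rcos_module by blast
next
  assume "x \<ominus> y \<in> J"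
  then have "x \<in> J +> y"
    unfolding a_minus_def using assms J.a_rcos_module by blast
  then show "J +> x = J +> y"
    using assms J.a_repr_independence' by blast
qed

lemma coset_eq_ideal_iff:
  assumes "x \<in> carrier A"
  shows "J +> x = J \<longleftrightarrow> x \<in> J"
  using assms J.a_rcos_const J.a_rcos_self by blast

text \<open>The product and the scalar multiples of cosets are unions over all representatives; each of
  these unions is a single coset because all its members coincide.\<close>

lemma coset_mult:
  assumes "x \<in> carrier A" "y \<in> carrier A"
  shows "rcoset_mult A J (J +> x) (J +> y) = J +> (x \<otimes> y)"
proof -
  have "J +> (a \<otimes> b) = J +> (x \<otimes> y)" if "a \<in> J +> x" "b \<in> J +> y" for a b
  proof -
    obtain i j where ij: "i \<in> J" "a = i \<oplus> x" "j \<in> J" "b = j \<oplus> y"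
      using \<open>a \<in> J +> x\<close> \<open>b \<in> J +> y\<close> by (auto simp: mem_coset_iff)
    have car: "i \<in> carrier A" "j \<in> carrier A" using ij ideal_subset by auto
    let ?k = "i \<otimes> b \<oplus> x \<otimes> j"
    have k: "?k \<in> J" using ij assms car by (intro ideal_add ideal_mult) auto
    have "a \<otimes> b = ?k \<oplus> x \<otimes> y"
      using car assms ij by (simp add: mult_add_left mult_add_right mult_closed a_assoc a_lcomm)
    then have "a \<otimes> b \<in> J +> (x \<otimes> y)" using k by (auto simp: mem_coset_iff)
    then show ?thesis
      using assms mult_closed J.a_repr_independence' by metis
  qed
  moreover have "x \<in> J +> x" "y \<in> J +> y" using assms J.a_rcos_self by auto
  ultimately show ?thesis unfolding rcoset_mult_def by blast
qed

lemma coset_smult: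
  assumes "x \<in> carrier A"
  shows "(\<Union>a\<in>J +> x. J +> (c \<odot> a)) = J +> (c \<odot> x)"
proof -
  have "J +> (c \<odot> a) = J +> (c \<odot> x)" if "a \<in> J +> x" for a
  proof -
    obtain i where i: "i \<in> J" "a = i \<oplus> x"
      using \<open>a \<in> J +> x\<close> by (auto simp: mem_coset_iff)
    then have "c \<odot> a = c \<odot> i \<oplus> c \<odot> x"
      using assms ideal_subset by (auto simp: smult_r_distr)
    then have "c \<odot> a \<in> J +> (c \<odot> x)" using i ideal_smult by (auto simp: mem_coset_iff)
    then show ?thesis
      using assms J.a_repr_independence' by (metis smult_closed base_field_simps(1) UNIV_I)
  qed
  moreover have "x \<in> J +> x" using assms J.a_rcos_self by auto
  ultimately show ?thesis by blast
qed

abbreviation "Q \<equiv> quotient_superalgebra A J"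

lemma quotient_simps:
  "carrier Q = (\<lambda>x. J +> x) ` carrier A" "zero Q = J" "part Q i = (\<lambda>x. J +> x) ` part A i"
  by (auto simp: quotient_superalgebra_def A_RCOSETS_def')

sublocale algebra_hom A Q "\<lambda>x. J +> x"
proof unfold_locales
  show "J +> \<zero> = \<zero>\<^bsub>Q\<^esub>" by (simp add: quotient_simps coset_eq_ideal_iff J.zero_closed)
qed (auto simp: quotient_superalgebra_def A_RCOSETS_def' J.a_rcos_sum coset_mult coset_smult)

lemma nonassoc_algebra_quotient: "nonassoc_algebra Q"
  by (rule surjective_image_nonassoc_algebra) (simp add: quotient_simps)

text \<open>Gradedness of the ideal enters where the two parts of the quotient must meet in zero only: if an
  even and an odd element are congruent, then their difference has its components in the ideal, and
  by uniqueness of components these are the two elements up to sign.\<close>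

lemma superalgebra_quotient: "superalgebra Q"
proof -
  interpret Q: nonassoc_algebra Q by (rule nonassoc_algebra_quotient)
  note sub = subsetD[OF part_subset]
  note psub = part_submodule
  show ?thesis
  proof (intro superalgebra.intro nonassoc_algebra_quotient superalgebra_axioms.intro)
    fix i
    show "submodule (part Q i) base_field Q"
    proof (rule Q.submoduleI)
      show "part Q i \<subseteq> carrier Q" using part_subset by (auto simp: quotient_simps)
      show "\<zero>\<^bsub>Q\<^esub> \<in> part Q i"
        unfolding hom_zero[symmetric] by (auto simp: quotient_simps(3) zero_in_part)
    next
      fix X assume "X \<in> part Q i"
      then obtain x where x: "x \<in> part A i" "X = J +> x" by (auto simp: quotient_simps)
      have "\<ominus>\<^bsub>Q\<^esub> X = J +> (\<ominus> x)"
      proof (rule Q.minus_equality)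
        show "(J +> \<ominus> x) \<oplus>\<^bsub>Q\<^esub> X = \<zero>\<^bsub>Q\<^esub>"
          using sub[OF x(1)] by (simp add: x(2) hom_zero l_neg flip: hom_add)
      qed (use sub[OF x(1)] in \<open>auto simp: x(2) hom_mem\<close>)
      then show "\<ominus>\<^bsub>Q\<^esub> X \<in> part Q i"
        using x submoduleE(3)[OF psub] by (auto simp: quotient_simps)
    next
      fix X Y assume "X \<in> part Q i" "Y \<in> part Q i"
      then obtain x y where "x \<in> part A i" "X = J +> x" "y \<in> part A i" "Y = J +> y"
        by (auto simp: quotient_simps)
      then show "X \<oplus>\<^bsub>Q\<^esub> Y \<in> part Q i"
        using submoduleE(5)[OF psub, of x i y] sub by (auto simp: quotient_simps simp flip: hom_add)
    next
      fix c X assume "X \<in> part Q i"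
      then obtain x where "x \<in> part A i" "X = J +> x" by (auto simp: quotient_simps)
      then show "c \<odot>\<^bsub>Q\<^esub> X \<in> part Q i"
        using submoduleE(4)[OF psub, of c x i] sub by (auto simp: quotient_simps simp flip: hom_smult)
    qed
  next
    fix X assume "X \<in> carrier Q"
    then obtain x where x: "x \<in> carrier A" "X = J +> x" by (auto simp: quotient_simps)
    then obtain y z where yz: "y \<in> part A False" "z \<in> part A True" "x = y \<oplus> z"
      using part_sum by blast
    then have "X = (J +> y) \<oplus>\<^bsub>Q\<^esub> (J +> z)" using x sub by (simp add: hom_add)
    then show "\<exists>Y\<in>part Q False. \<exists>Z\<in>part Q True. X = Y \<oplus>\<^bsub>Q\<^esub> Z"
      using yz by (auto simp: quotient_simps)
  next
    have "J +> y = J" if y: "y \<in> part A False" and z: "z \<in> part A True" and eq: "J +> y = J +> z" for y z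
    proof -
      note car = sub[OF y] sub[OF z]
      have "y \<ominus> z \<in> J" using eq coset_eq_iff car by blast
      then obtain a b where ab: "a \<in> J \<inter> part A False" "b \<in> J \<inter> part A True" "y \<ominus> z = a \<oplus> b"
        using graded_ideal unfolding graded_ideal_def by blast
      have "y = a"
        using ab y z homogeneous_components_unique(1)[of y "\<ominus> z" a b] submoduleE(3)[OF psub]
        unfolding a_minus_def by blast
      then show ?thesis using ab car coset_eq_ideal_iff by blast
    qed
    then have "part Q False \<inter> part Q True \<subseteq> {J}" by (auto simp: quotient_simps)
    moreover have "J \<in> part Q i" for i
      using zero_in_part[of i] hom_zero unfolding quotient_simps by force
    ultimately show "part Q False \<inter> part Q True = {\<zero>\<^bsub>Q\<^esub>}" by (auto simp: quotient_simps(2))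
  next
    fix X i Y j assume "X \<in> part Q i" "Y \<in> part Q j"
    then obtain x y where "x \<in> part A i" "X = J +> x" "y \<in> part A j" "Y = J +> y"
      by (auto simp: quotient_simps)
    then show "X \<otimes>\<^bsub>Q\<^esub> Y \<in> part Q (i \<noteq> j)"
      using part_mult[of x i y j] sub unfolding quotient_simps(3)
      by (metis hom_mult image_eqI)
  qed
qed

end

section \<open>The Grassmann envelope\<close>

lemma grassmann_sign_nonzero: "grassmann_sign S T \<noteq> (0::'f::field)"
  by (simp add: grassmann_sign_def)

lemma (in nonassoc_algebra) mult_zero_left: "x \<in> carrier A \<Longrightarrow> \<zero> \<otimes> x = \<zero>"
  using mult_smult_left[of \<zero> x 0] smult_l_null[simplified] mult_closed by simp

lemma (in nonassoc_algebra) mult_zero_right: "x \<in> carrier A \<Longrightarrow> x \<otimes> \<zero> = \<zero>"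
  using mult_smult_right[of x \<zero> 0] smult_l_null[simplified] mult_closed by simp

lemma (in nonassoc_algebra) smult_eq_zero:
  assumes "c \<odot> x = \<zero>" "c \<noteq> 0" "x \<in> carrier A"
  shows "x = \<zero>"
proof -
  have "x = (inverse c * c) \<odot> x" using assms smult_one by simp
  also have "\<dots> = inverse c \<odot> (c \<odot> x)" using assms smult_assoc1[of "inverse c" c x] by (simp only: base_field_simps UNIV_I)
  finally show ?thesis using assms by simp
qed

lemma (in nonassoc_algebra) finsum_mem:
  assumes "D \<subseteq> carrier A" "\<zero> \<in> D" "\<And>x y. x \<in> D \<Longrightarrow> y \<in> D \<Longrightarrow> x \<oplus> y \<in> D"
    and "\<And>k. k \<in> K \<Longrightarrow> g k \<in> D"
  shows "(\<Oplus>k\<in>K. g k) \<in> D"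
proof (cases "finite K")
  case True
  then show ?thesis using assms(4)
  proof (induction K)
    case (insert k K)
    then have "(\<Oplus>k\<in>insert k K. g k) = g k \<oplus> (\<Oplus>k\<in>K. g k)"
      using assms(1) by (intro M.finsum_insert) auto
    then show ?case using insert assms(3) by simp
  qed (simp add: assms(2))
qed (simp add: assms(2) M.finsum_infinite)

lemma (in superalgebra) carrier_induct [consumes 1, case_names homogeneous add]:
  assumes "x \<in> carrier A"
    and "\<And>i y. y \<in> part A i \<Longrightarrow> P y"
    and "\<And>y z. y \<in> carrier A \<Longrightarrow> z \<in> carrier A \<Longrightarrow> P y \<Longrightarrow> P z \<Longrightarrow> P (y \<oplus> z)"
  shows "P x"
proof -
  obtain y z where "y \<in> part A False" "z \<in> part A True" "x = y \<oplus> z"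
    using part_sum[OF assms(1)] by blast
  then show ?thesis using assms(2,3) part_subset by (simp add: subset_iff)
qed

lemma satisfies_single:
  assumes "nonassoc_algebra B"
  shows "satisfies B (Poly_Mapping.single m 1) \<longleftrightarrow>
    (\<forall>a. (\<forall>i. a i \<in> carrier B) \<longrightarrow> eval_monom B a m = \<zero>\<^bsub>B\<^esub>)"
proof -
  interpret B: nonassoc_algebra B by fact
  have "eval_poly B a (Poly_Mapping.single m 1) = eval_monom B a m" if "\<forall>i. a i \<in> carrier B" for a
  proof -
    have "eval_monom B a m \<in> carrier B"
      using that by (induction m) (simp_all add: B.mult_closed)
    then show ?thesis
      using B.smult_one[of "eval_monom B a m"] by (simp add: eval_poly_def B.M.finsum_insert)
  qed
  then show ?thesis
    unfolding satisfies_def by metis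
qed

context superalgebra
begin

abbreviation "E \<equiv> grassmann_envelope A"

lemma mem_envelope_iff:
  "u \<in> carrier E \<longleftrightarrow> finite {S. u S \<noteq> \<zero>} \<and> (\<forall>S. u S \<noteq> \<zero> \<longrightarrow> finite S) \<and>
    (\<forall>S. u S \<in> part A (odd (card S)))"
  by (simp add: grassmann_envelope_def)

lemma envelope_simps:
  "u \<oplus>\<^bsub>E\<^esub> v = (\<lambda>S. u S \<oplus> v S)" "\<zero>\<^bsub>E\<^esub> = (\<lambda>S. \<zero>)" "c \<odot>\<^bsub>E\<^esub> u = (\<lambda>S. c \<odot> u S)"
  by (simp_all add: grassmann_envelope_def)

lemma envelope_mult:
  "(u \<otimes>\<^bsub>E\<^esub> v) S =
    (if finite S then \<Oplus>T\<in>Pow S. grassmann_sign T (S - T) \<odot> (u T \<otimes> v (S - T)) else \<zero>)"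
  by (simp add: grassmann_envelope_def)

lemma envelope_value_in_carrier: "u \<in> carrier E \<Longrightarrow> u S \<in> carrier A"
  using part_subset by (auto simp: mem_envelope_iff)

lemma envelope_mult_in_part:
  assumes "u \<in> carrier E" "v \<in> carrier E"
  shows "(u \<otimes>\<^bsub>E\<^esub> v) S \<in> part A (odd (card S))"
proof (cases "finite S")
  case True
  have "(\<Oplus>T\<in>Pow S. grassmann_sign T (S - T) \<odot> (u T \<otimes> v (S - T))) \<in> part A (odd (card S))"
  proof (rule finsum_mem)
    fix T assume T: "T \<in> Pow S"
    with True have "card S = card T + card (S - T)"
      by (metis PowD card_Diff_subset card_mono finite_subset le_add_diff_inverse)
    then have "odd (card S) = (odd (card T) \<noteq> odd (card (S - T)))" by simp
    moreover have "u T \<otimes> v (S - T) \<in> part A (odd (card T) \<noteq> odd (card (S - T)))"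
      using assms by (intro part_mult) (auto simp: mem_envelope_iff)
    ultimately show "grassmann_sign T (S - T) \<odot> (u T \<otimes> v (S - T)) \<in> part A (odd (card S))"
      using submoduleE(4)[OF part_submodule] by simp
  qed (use part_subset zero_in_part submoduleE(5)[OF part_submodule] in auto)
  then show ?thesis using True by (simp add: envelope_mult)
qed (simp add: envelope_mult zero_in_part)

lemma envelope_mult_closed:
  assumes "u \<in> carrier E" "v \<in> carrier E"
  shows "u \<otimes>\<^bsub>E\<^esub> v \<in> carrier E"
proof -
  have "{S. (u \<otimes>\<^bsub>E\<^esub> v) S \<noteq> \<zero>} \<subseteq> (\<lambda>(T, U). T \<union> U) ` ({S. u S \<noteq> \<zero>} \<times> {S. v S \<noteq> \<zero>})"
  proof
    fix S assume "S \<in> {S. (u \<otimes>\<^bsub>E\<^esub> v) S \<noteq> \<zero>}"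
    then have "finite S"
      and ne: "(\<Oplus>T\<in>Pow S. grassmann_sign T (S - T) \<odot> (u T \<otimes> v (S - T))) \<noteq> \<zero>"
      by (auto simp: envelope_mult split: if_splits)
    obtain T where T: "T \<in> Pow S" "grassmann_sign T (S - T) \<odot> (u T \<otimes> v (S - T)) \<noteq> \<zero>"
      using ne M.add.finprod_one_eqI[of "Pow S"] by meson
    then have "u T \<noteq> \<zero>" "v (S - T) \<noteq> \<zero>"
      using assms envelope_value_in_carrier mult_zero_left mult_zero_right by auto
    then show "S \<in> (\<lambda>(T, U). T \<union> U) ` ({S. u S \<noteq> \<zero>} \<times> {S. v S \<noteq> \<zero>})"
      using T by (intro image_eqI[of _ _ "(T, S - T)"]) auto
  qed
  moreover have "finite ({S. u S \<noteq> \<zero>} \<times> {S. v S \<noteq> \<zero>})"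
    using assms by (simp add: mem_envelope_iff)
  ultimately have "finite {S. (u \<otimes>\<^bsub>E\<^esub> v) S \<noteq> \<zero>}"
    by (meson finite_imageI finite_subset)
  then show ?thesis
    using envelope_mult_in_part[OF assms] by (auto simp: mem_envelope_iff envelope_mult)
qed

lemma nonassoc_algebra_envelope: "nonassoc_algebra E"
proof -
  note val = envelope_value_in_carrier
  have add_closed: "u \<oplus>\<^bsub>E\<^esub> v \<in> carrier E" if "u \<in> carrier E" "v \<in> carrier E" for u v
  proof -
    have "{S. u S \<oplus> v S \<noteq> \<zero>} \<subseteq> {S. u S \<noteq> \<zero>} \<union> {S. v S \<noteq> \<zero>}" by auto
    moreover have "finite S" if "u S \<oplus> v S \<noteq> \<zero>" for S
      using that \<open>u \<in> carrier E\<close> \<open>v \<in> carrier E\<close> unfolding mem_envelope_iff by (metis r_zero M.zero_closed)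
    ultimately show ?thesis
      using that submoduleE(5)[OF part_submodule]
      by (auto simp: mem_envelope_iff envelope_simps intro: finite_subset)
  qed
  have smult_closed: "c \<odot>\<^bsub>E\<^esub> u \<in> carrier E" if "u \<in> carrier E" for c u
  proof -
    have "{S. c \<odot> u S \<noteq> \<zero>} \<subseteq> {S. u S \<noteq> \<zero>}" by auto
    then show ?thesis
      using that submoduleE(4)[OF part_submodule]
      by (auto simp: mem_envelope_iff envelope_simps intro: finite_subset)
  qed
  have "abelian_group E"
  proof (rule abelian_groupI)
    fix u assume u: "u \<in> carrier E"
    have "(- 1) \<odot>\<^bsub>E\<^esub> u \<oplus>\<^bsub>E\<^esub> u = \<zero>\<^bsub>E\<^esub>"
    proof
      fix S
      have "(- 1) \<odot> u S \<oplus> u S = (- 1) \<odot> u S \<oplus> 1 \<odot> u S"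
        using val[OF u] smult_one by simp
      also have "\<dots> = \<zero>"
        using val[OF u] smult_l_distr[of "- 1" 1 "u S"] smult_l_null by simp
      finally show "((- 1) \<odot>\<^bsub>E\<^esub> u \<oplus>\<^bsub>E\<^esub> u) S = \<zero>\<^bsub>E\<^esub> S"
        by (simp add: envelope_simps)
    qed
    then show "\<exists>v\<in>carrier E. v \<oplus>\<^bsub>E\<^esub> u = \<zero>\<^bsub>E\<^esub>"
      using smult_closed[OF u] by blast
  next
    show "\<zero>\<^bsub>E\<^esub> \<in> carrier E" by (simp add: mem_envelope_iff envelope_simps zero_in_part)
  next
    fix u v assume "u \<in> carrier E" "v \<in> carrier E"
    then show "u \<oplus>\<^bsub>E\<^esub> v = v \<oplus>\<^bsub>E\<^esub> u"
      by (simp add: envelope_simps a_comm val)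
  next
    fix u assume "u \<in> carrier E"
    then show "\<zero>\<^bsub>E\<^esub> \<oplus>\<^bsub>E\<^esub> u = u" by (simp add: envelope_simps val)
  qed (simp_all add: add_closed, simp add: envelope_simps a_assoc val)
  then have "module base_field E"
    by (intro moduleI[OF cring_base_field])
      (simp_all add: smult_closed, simp_all add: envelope_simps val
        smult_l_distr[simplified] smult_r_distr[simplified] smult_assoc1[simplified]
        smult_one[simplified])
  moreover have "(u \<oplus>\<^bsub>E\<^esub> v) \<otimes>\<^bsub>E\<^esub> w = u \<otimes>\<^bsub>E\<^esub> w \<oplus>\<^bsub>E\<^esub> v \<otimes>\<^bsub>E\<^esub> w"
    and "w \<otimes>\<^bsub>E\<^esub> (u \<oplus>\<^bsub>E\<^esub> v) = w \<otimes>\<^bsub>E\<^esub> u \<oplus>\<^bsub>E\<^esub> w \<otimes>\<^bsub>E\<^esub> v"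
    if uvw: "u \<in> carrier E" "v \<in> carrier E" "w \<in> carrier E" for u v w
  proof -
    show "(u \<oplus>\<^bsub>E\<^esub> v) \<otimes>\<^bsub>E\<^esub> w = u \<otimes>\<^bsub>E\<^esub> w \<oplus>\<^bsub>E\<^esub> v \<otimes>\<^bsub>E\<^esub> w"
      using uvw by (simp add: fun_eq_iff envelope_simps envelope_mult mult_add_left val
          smult_r_distr mult_closed M.finsum_addf Pi_iff)
    show "w \<otimes>\<^bsub>E\<^esub> (u \<oplus>\<^bsub>E\<^esub> v) = w \<otimes>\<^bsub>E\<^esub> u \<oplus>\<^bsub>E\<^esub> w \<otimes>\<^bsub>E\<^esub> v"
      using uvw by (simp add: fun_eq_iff envelope_simps envelope_mult mult_add_right val
          smult_r_distr mult_closed M.finsum_addf Pi_iff)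
  qed
  moreover have "(c \<odot>\<^bsub>E\<^esub> u) \<otimes>\<^bsub>E\<^esub> w = c \<odot>\<^bsub>E\<^esub> (u \<otimes>\<^bsub>E\<^esub> w)"
    and "u \<otimes>\<^bsub>E\<^esub> (c \<odot>\<^bsub>E\<^esub> w) = c \<odot>\<^bsub>E\<^esub> (u \<otimes>\<^bsub>E\<^esub> w)"
    if uw: "u \<in> carrier E" "w \<in> carrier E" for c u w
  proof -
    have swap: "a \<odot> (c \<odot> x) = c \<odot> (a \<odot> x)" if "x \<in> carrier A" for a x
      using that smult_assoc1[of a c x] smult_assoc1[of c a x] by (simp add: mult.commute)
    have scale: "c \<odot> (\<Oplus>T\<in>Pow S. g T) = (\<Oplus>T\<in>Pow S. c \<odot> g T)"
      if "finite S" "\<And>T. g T \<in> carrier A" for S :: "nat set" and g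
      using that by (intro finsum_smult_ldistr) auto
    show "(c \<odot>\<^bsub>E\<^esub> u) \<otimes>\<^bsub>E\<^esub> w = c \<odot>\<^bsub>E\<^esub> (u \<otimes>\<^bsub>E\<^esub> w)"
      using uw by (simp add: fun_eq_iff envelope_simps envelope_mult mult_smult_left val
          mult_closed scale swap)
    show "u \<otimes>\<^bsub>E\<^esub> (c \<odot>\<^bsub>E\<^esub> w) = c \<odot>\<^bsub>E\<^esub> (u \<otimes>\<^bsub>E\<^esub> w)"
      using uw by (simp add: fun_eq_iff envelope_simps envelope_mult mult_smult_right val
          mult_closed scale swap)
  qed
  ultimately show ?thesis
    by (intro nonassoc_algebra.intro nonassoc_algebra_axioms.intro) (auto simp: envelope_mult_closed)
qed

text \<open>The element \<open>e\<^sub>S \<otimes> x\<close> of the envelope.\<close>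

definition pure_tensor :: "nat set \<Rightarrow> 'a \<Rightarrow> nat set \<Rightarrow> 'a" where
  "pure_tensor S x = (\<lambda>T. if T = S then x else \<zero>)"

lemma pure_tensor_in_envelope:
  assumes "finite S" "x \<in> part A (odd (card S))"
  shows "pure_tensor S x \<in> carrier E"
  using assms by (auto simp: mem_envelope_iff pure_tensor_def zero_in_part)

lemma pure_tensor_mult:
  assumes "finite S" "finite T" "S \<inter> T = {}" and x: "x \<in> carrier A" and y: "y \<in> carrier A"
  shows "pure_tensor S x \<otimes>\<^bsub>E\<^esub> pure_tensor T y =
    pure_tensor (S \<union> T) (grassmann_sign S T \<odot> (x \<otimes> y))"
proof
  fix U
  let ?t = "grassmann_sign S T \<odot> (x \<otimes> y)"
  have t: "?t \<in> carrier A" using x y mult_closed by simp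
  show "(pure_tensor S x \<otimes>\<^bsub>E\<^esub> pure_tensor T y) U = pure_tensor (S \<union> T) ?t U"
  proof (cases "finite U")
    case True
    have "(pure_tensor S x \<otimes>\<^bsub>E\<^esub> pure_tensor T y) U =
      (\<Oplus>V\<in>Pow U. if S = V then (if U = S \<union> T then ?t else \<zero>) else \<zero>)"
      unfolding envelope_mult if_P[OF True]
      using assms t
      by (intro M.finsum_cong')
        (auto simp: pure_tensor_def mult_zero_left mult_zero_right Un_Diff Diff_triv Int_commute)
    also have "\<dots> = pure_tensor (S \<union> T) ?t U"
    proof (cases "U = S \<union> T")
      case True
      then show ?thesis
        using M.finsum_singleton[of S "Pow U" "\<lambda>_. ?t"] t \<open>finite U\<close> by (simp add: pure_tensor_def)
    next
      case False
      then have "(\<Oplus>V\<in>Pow U. if S = V then (if U = S \<union> T then ?t else \<zero>) else \<zero>) =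
          (\<Oplus>V\<in>Pow U. \<zero>)"
        by simp
      then show ?thesis using False by (simp add: pure_tensor_def)
    qed
    finally show ?thesis .
  qed (use assms in \<open>auto simp: envelope_mult pure_tensor_def\<close>)
qed

text \<open>Tensoring the four homogeneous elements with Grassmann words in pairwise different generators
  (the empty word for an even element) makes the product in the envelope a nonzero multiple of one
  pure tensor, so its vanishing gives the identity in the superalgebra without signs.\<close>

lemma metabelian_envelope_imp_homogeneous:
  assumes E: "satisfies E (Poly_Mapping.single (Mul (Mul (Gen 0) (Gen 1)) (Mul (Gen 2) (Gen 3))) 1)"
    and "x \<in> part A i" "y \<in> part A j" "z \<in> part A k" "t \<in> part A l"
  shows "(x \<otimes> y) \<otimes> (z \<otimes> t) = \<zero>"
proof -
  define S where "S = (\<lambda>n i. if i then {n::nat} else {})"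
  have S: "finite (S n i)" "odd (card (S n i)) = i" for n i by (auto simp: S_def)
  have car: "x \<in> carrier A" "y \<in> carrier A" "z \<in> carrier A" "t \<in> carrier A"
    using assms(2-5)[THEN subsetD[OF part_subset]] .
  define a where "a = (\<lambda>_::nat. pure_tensor {} \<zero>)(0 := pure_tensor (S 0 i) x, 1 := pure_tensor (S 1 j) y,
      2 := pure_tensor (S 2 k) z, 3 := pure_tensor (S 3 l) t)"
  have "a n \<in> carrier E" for n
    using assms(2-5) S zero_in_part by (simp add: a_def pure_tensor_in_envelope)
  then have "eval_monom E a (Mul (Mul (Gen 0) (Gen 1)) (Mul (Gen 2) (Gen 3))) = \<zero>\<^bsub>E\<^esub>"
    by (intro satisfies_single[OF nonassoc_algebra_envelope, THEN iffD1, OF E, rule_format])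
  then have "(pure_tensor (S 0 i) x \<otimes>\<^bsub>E\<^esub> pure_tensor (S 1 j) y) \<otimes>\<^bsub>E\<^esub>
      (pure_tensor (S 2 k) z \<otimes>\<^bsub>E\<^esub> pure_tensor (S 3 l) t) = \<zero>\<^bsub>E\<^esub>"
    by (simp add: a_def)
  moreover have "S 0 i \<inter> S 1 j = {}" "S 2 k \<inter> S 3 l = {}"
    "(S 0 i \<union> S 1 j) \<inter> (S 2 k \<union> S 3 l) = {}"
    by (auto simp: S_def)
  ultimately have "pure_tensor ((S 0 i \<union> S 1 j) \<union> (S 2 k \<union> S 3 l))
      (grassmann_sign (S 0 i \<union> S 1 j) (S 2 k \<union> S 3 l) \<odot>
        ((grassmann_sign (S 0 i) (S 1 j) \<odot> (x \<otimes> y)) \<otimes> (grassmann_sign (S 2 k) (S 3 l) \<odot> (z \<otimes> t))))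
      = \<zero>\<^bsub>E\<^esub>"
    using S car by (simp add: pure_tensor_mult mult_closed)
  from fun_cong[OF this, of "(S 0 i \<union> S 1 j) \<union> (S 2 k \<union> S 3 l)"]
  have "grassmann_sign (S 0 i \<union> S 1 j) (S 2 k \<union> S 3 l) \<odot>
      (grassmann_sign (S 2 k) (S 3 l) \<odot> (grassmann_sign (S 0 i) (S 1 j) \<odot> ((x \<otimes> y) \<otimes> (z \<otimes> t)))) = \<zero>"
    using car by (simp add: pure_tensor_def envelope_simps mult_smult_left mult_smult_right mult_closed)
  then show ?thesis
    by (rule smult_eq_zero[OF smult_eq_zero[OF smult_eq_zero]])
      (simp_all add: grassmann_sign_nonzero mult_closed car)
qed

text \<open>The coefficients of a product in the envelope are sums of products. The set \<open>L\<close> of elements that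
  annihilate all products from the left, and then the set \<open>R\<close> of elements that \<open>L\<close> annihilates, are
  closed under sums, so they contain these coefficients.\<close>

lemma metabelian_imp_envelope:
  assumes M: "\<And>x y z t. \<lbrakk>x \<in> carrier A; y \<in> carrier A; z \<in> carrier A; t \<in> carrier A\<rbrakk> \<Longrightarrow>
      (x \<otimes> y) \<otimes> (z \<otimes> t) = \<zero>"
    and u: "u \<in> carrier E" "v \<in> carrier E" "w \<in> carrier E" "q \<in> carrier E"
  shows "(u \<otimes>\<^bsub>E\<^esub> v) \<otimes>\<^bsub>E\<^esub> (w \<otimes>\<^bsub>E\<^esub> q) = \<zero>\<^bsub>E\<^esub>"
proof -
  define L where "L = {d \<in> carrier A. \<forall>z\<in>carrier A. \<forall>t\<in>carrier A. d \<otimes> (z \<otimes> t) = \<zero>}"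
  define R where "R = {e \<in> carrier A. \<forall>d\<in>L. d \<otimes> e = \<zero>}"
  note val = envelope_value_in_carrier
  have L: "(u \<otimes>\<^bsub>E\<^esub> v) S \<in> L" for S
  proof -
    have zero: "\<zero> \<in> L" by (auto simp: L_def mult_zero_left mult_closed)
    moreover have "(\<Oplus>T\<in>Pow S. grassmann_sign T (S - T) \<odot> (u T \<otimes> v (S - T))) \<in> L"
      by (rule finsum_mem)
        (use zero u in \<open>auto simp: L_def mult_add_left mult_closed val mult_smult_left M\<close>)
    ultimately show ?thesis by (simp add: envelope_mult)
  qed
  have R: "(w \<otimes>\<^bsub>E\<^esub> q) S \<in> R" for S
  proof -
    have zero: "\<zero> \<in> R" by (auto simp: R_def L_def mult_zero_right)
    moreover have "(\<Oplus>T\<in>Pow S. grassmann_sign T (S - T) \<odot> (w T \<otimes> q (S - T))) \<in> R"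
      by (rule finsum_mem)
        (use zero u in \<open>auto simp: R_def L_def mult_add_right mult_closed val mult_smult_right\<close>)
    ultimately show ?thesis by (simp add: envelope_mult)
  qed
  have "(u \<otimes>\<^bsub>E\<^esub> v) T \<otimes> (w \<otimes>\<^bsub>E\<^esub> q) S = \<zero>" for T S
    using L R by (auto simp: R_def)
  then show ?thesis by (simp add: fun_eq_iff envelope_mult[of "u \<otimes>\<^bsub>E\<^esub> v"] envelope_simps)
qed

end

text \<open>The variables of the only monomial of the metabelian identity stand in increasing order, so its
  superization carries no sign and the grading disappears from the condition.\<close>

lemma super_class_metabelian_iff:
  fixes A :: "('f::field, 'a) superalg" (structure)
  shows "A \<in> super_class metabelian \<longleftrightarrow> superalgebra A \<and>
    (\<forall>x\<in>carrier A. \<forall>y\<in>carrier A. \<forall>z\<in>carrier A. \<forall>t\<in>carrier A. (x \<otimes> y) \<otimes> (z \<otimes> t) = \<zero>)"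
    (is "?L \<longleftrightarrow> _ \<and> ?R")
proof (cases "superalgebra A")
  case True
  then interpret superalgebra A .
  let ?m = "Mul (Mul (Gen 0) (Gen 1)) (Mul (Gen 2) (Gen 3)) :: nat monom"
  have L: "?L \<longleftrightarrow> satisfies E (Poly_Mapping.single ?m 1)"
    by (simp add: super_class_def variety_def metabelian_def nonassoc_algebra_envelope True)
  have ?R if E: "satisfies E (Poly_Mapping.single ?m 1)"
  proof (intro ballI)
    fix x y z t
    assume "x \<in> carrier A" and y: "y \<in> carrier A" and z: "z \<in> carrier A" and t: "t \<in> carrier A"
    note add = mult_add_left mult_add_right mult_closed
    show "(x \<otimes> y) \<otimes> (z \<otimes> t) = \<zero>"
      using \<open>x \<in> carrier A\<close>
    proof (induction rule: carrier_induct)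
      case (homogeneous i x)
      from y show ?case
      proof (induction rule: carrier_induct)
        case (homogeneous j y)
        from z show ?case
        proof (induction rule: carrier_induct)
          case (homogeneous k z)
          from t show ?case
          proof (induction rule: carrier_induct)
            case (homogeneous l t)
            show ?case by (rule metabelian_envelope_imp_homogeneous) fact+
          qed (use \<open>x \<in> part A i\<close> \<open>y \<in> part A j\<close> \<open>z \<in> part A k\<close> part_subset in \<open>simp add: add subset_iff\<close>)
        qed (use \<open>x \<in> part A i\<close> \<open>y \<in> part A j\<close> t part_subset in \<open>simp add: add subset_iff\<close>)
      qed (use \<open>x \<in> part A i\<close> z t part_subset in \<open>simp add: add subset_iff\<close>)
    qed (use y z t in \<open>simp add: add\<close>)
  qed
  moreover have "satisfies E (Poly_Mapping.single ?m 1)" if ?R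
    unfolding satisfies_single[OF nonassoc_algebra_envelope]
    using that metabelian_imp_envelope by simp
  ultimately show ?thesis using True L by blast
qed (simp add: super_class_def)

section \<open>Metabelian quotients\<close>

lemma (in graded_quotient) quotient_metabelian_iff:
  "Q \<in> super_class metabelian \<longleftrightarrow>
    (\<forall>x\<in>carrier A. \<forall>y\<in>carrier A. \<forall>z\<in>carrier A. \<forall>t\<in>carrier A. (x \<otimes> y) \<otimes> (z \<otimes> t) \<in> J)"
proof -
  have "((J +> x) \<otimes>\<^bsub>Q\<^esub> (J +> y)) \<otimes>\<^bsub>Q\<^esub> ((J +> z) \<otimes>\<^bsub>Q\<^esub> (J +> t)) = \<zero>\<^bsub>Q\<^esub> \<longleftrightarrow>
      (x \<otimes> y) \<otimes> (z \<otimes> t) \<in> J"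
    if "x \<in> carrier A" "y \<in> carrier A" "z \<in> carrier A" "t \<in> carrier A" for x y z t
    using that by (simp add: mult_closed quotient_simps(2) coset_eq_ideal_iff flip: hom_mult)
  then show ?thesis
    unfolding super_class_metabelian_iff by (simp add: superalgebra_quotient quotient_simps(1))
qed

lemma (in superalgebra) graded_ideal_carrier: "graded_ideal A (carrier A)"
  unfolding graded_ideal_def
proof (intro conjI)
  show "submodule (carrier A) base_field A"
    by (rule submoduleI) auto
  show "\<forall>a\<in>carrier A. \<forall>x\<in>carrier A. a \<otimes> x \<in> carrier A \<and> x \<otimes> a \<in> carrier A"
    by (simp add: mult_closed)
  show "\<forall>x\<in>carrier A. \<exists>y\<in>carrier A \<inter> part A False. \<exists>z\<in>carrier A \<inter> part A True. x = y \<oplus> z"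
    using part_sum Int_absorb1[OF part_subset] by simp
qed

text \<open>The components of an element of the intersection lie in every member, since by uniqueness they are
  the same for all members.\<close>

lemma (in superalgebra) graded_ideal_Inter:
  assumes ne: "\<F> \<noteq> {}" and id: "\<And>J. J \<in> \<F> \<Longrightarrow> graded_ideal A J"
  shows "graded_ideal A (\<Inter> \<F>)"
proof -
  have sub: "submodule J base_field A" if "J \<in> \<F>" for J
    using id[OF that] by (simp add: graded_ideal_def)
  note subE = submoduleE[OF sub]
  have zero: "\<zero> \<in> J" if "J \<in> \<F>" for J
    using subgroup.one_closed[OF submodule.axioms(1)[OF sub[OF that]]] by simp
  obtain J0 where J0: "J0 \<in> \<F>" using ne by auto
  have "submodule (\<Inter> \<F>) base_field A"
  proof (rule submoduleI)
    show "\<Inter> \<F> \<subseteq> carrier A" using subE(1)[OF J0] J0 by blast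
  qed (simp_all add: zero subE(3-5))
  moreover have "a \<otimes> x \<in> \<Inter> \<F> \<and> x \<otimes> a \<in> \<Inter> \<F>" if "a \<in> carrier A" "x \<in> \<Inter> \<F>" for a x
    using that id unfolding graded_ideal_def by simp
  moreover have "\<exists>y\<in>\<Inter> \<F> \<inter> part A False. \<exists>z\<in>\<Inter> \<F> \<inter> part A True. x = y \<oplus> z"
    if x: "x \<in> \<Inter> \<F>" for x
  proof -
    obtain y z where yz: "y \<in> part A False" "z \<in> part A True" "x = y \<oplus> z"
      using part_sum[of x] x subE(1)[OF J0] J0 by blast
    have "y \<in> J \<and> z \<in> J" if J: "J \<in> \<F>" for J
    proof -
      obtain y' z' where yz': "y' \<in> J \<inter> part A False" "z' \<in> J \<inter> part A True" "x = y' \<oplus> z'"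
        using id[OF J] x J unfolding graded_ideal_def by blast
      then have "y = y'" "z = z'"
        using homogeneous_components_unique[of y z y' z'] yz(1,2) unfolding yz(3) by simp_all
      then show ?thesis using yz' by simp
    qed
    then show ?thesis using yz by blast
  qed
  ultimately show ?thesis unfolding graded_ideal_def by blast
qed

lemma graded_quotient_free:
  assumes "graded_ideal (free_superalgebra r s) J"
  shows "graded_quotient (free_superalgebra r s) J"
  by (intro graded_quotient.intro graded_quotient_axioms.intro
      superalgebra_free_superalgebra assms)

text \<open>The defining intersection runs over a nonempty family, for the whole algebra belongs to it, so the
  intersection is a graded ideal and its quotient is a superalgebra.\<close>

lemma free_super_ideal_metabelian:
  fixes r s
  defines "F \<equiv> free_superalgebra r s :: ('f::field, (nat + nat, 'f) npoly) superalg"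
    and "J \<equiv> free_super_ideal metabelian r s"
  shows "graded_ideal F J"
    and "\<And>x y z t. \<lbrakk>x \<in> carrier F; y \<in> carrier F; z \<in> carrier F; t \<in> carrier F\<rbrakk> \<Longrightarrow>
      (x \<otimes>\<^bsub>F\<^esub> y) \<otimes>\<^bsub>F\<^esub> (z \<otimes>\<^bsub>F\<^esub> t) \<in> J"
proof -
  interpret superalgebra F
    unfolding F_def by (rule superalgebra_free_superalgebra)
  define \<F> where "\<F> = {J. graded_ideal F J \<and> quotient_superalgebra F J \<in> super_class metabelian}"
  have J: "J = \<Inter> \<F>" by (simp add: J_def free_super_ideal_def \<F>_def F_def)
  have quot: "graded_quotient F K" if "graded_ideal F K" for K
    using graded_quotient_free that unfolding F_def .
  have "carrier F \<in> \<F>"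
    using graded_ideal_carrier graded_quotient.quotient_metabelian_iff[OF quot]
    by (simp add: \<F>_def mult_closed)
  then show "graded_ideal F J"
    unfolding J by (intro graded_ideal_Inter) (auto simp: \<F>_def)
  fix x y z t assume "x \<in> carrier F" "y \<in> carrier F" "z \<in> carrier F" "t \<in> carrier F"
  then show "(x \<otimes>\<^bsub>F\<^esub> y) \<otimes>\<^bsub>F\<^esub> (z \<otimes>\<^bsub>F\<^esub> t) \<in> J"
    using graded_quotient.quotient_metabelian_iff[OF quot] by (auto simp: J \<F>_def)
qed

section \<open>Coefficients that cancel for finitely many generators\<close>

lemma underdetermined_system_solution:
  fixes M :: "'e \<Rightarrow> 'i \<Rightarrow> 'f::field"
  assumes "finite E" "finite I" "card E < card I"
  shows "\<exists>c. (\<exists>i\<in>I. c i \<noteq> 0) \<and> (\<forall>e\<in>E. (\<Sum>i\<in>I. M e i * c i) = 0)"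
  using assms
proof (induction E arbitrary: I M)
  case empty
  then have "\<exists>i. i \<in> I" by (metis card.empty equals0I less_irrefl)
  then show ?case by (intro exI[of _ "\<lambda>_. 1"]) simp
next
  case (insert e E)
  show ?case
  proof (cases "\<forall>i\<in>I. M e i = 0")
    case True
    have "card E < card I" using insert by simp
    then obtain c where "\<exists>i\<in>I. c i \<noteq> 0" "\<forall>e\<in>E. (\<Sum>i\<in>I. M e i * c i) = 0"
      using insert.IH[OF \<open>finite I\<close>, of M] by auto
    then show ?thesis using True by (intro exI[of _ c]) simp
  next
    case False
    \<comment> \<open>Eliminate the unknown with index \<open>i\<close> by means of equation \<open>e\<close>.\<close>
    then obtain i where i: "i \<in> I" "M e i \<noteq> 0" by auto
    define I' where "I' = I - {i}"
    have "finite I'" "card E < card I'" using insert i by (simp_all add: I'_def)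
    then obtain c where c: "\<exists>j\<in>I'. c j \<noteq> 0"
      "\<And>e'. e' \<in> E \<Longrightarrow> (\<Sum>j\<in>I'. (M e' j - M e' i / M e i * M e j) * c j) = 0"
      using insert.IH[of I' "\<lambda>e' j. M e' j - M e' i / M e i * M e j"] by auto
    define s where "s = (\<Sum>j\<in>I'. M e j * c j)"
    define d where "d = c(i := - s / M e i)"
    have sum: "(\<Sum>j\<in>I. M e' j * d j) = M e' i * (- s / M e i) + (\<Sum>j\<in>I'. M e' j * c j)" for e'
    proof -
      have "(\<Sum>j\<in>I. M e' j * d j) = M e' i * d i + (\<Sum>j\<in>I'. M e' j * d j)"
        using i insert by (simp add: I'_def sum.remove)
      also have "(\<Sum>j\<in>I'. M e' j * d j) = (\<Sum>j\<in>I'. M e' j * c j)"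
        by (intro sum.cong) (auto simp: d_def I'_def)
      finally show ?thesis by (simp add: d_def)
    qed
    have "(\<Sum>j\<in>I. M e' j * d j) = 0" if "e' \<in> insert e E" for e'
    proof (cases "e' = e")
      case True
      then show ?thesis using i by (simp add: sum flip: s_def)
    next
      case False
      with that have "e' \<in> E" by simp
      from c(2)[OF this] have "(\<Sum>j\<in>I'. M e' j * c j) = (\<Sum>j\<in>I'. M e' i / M e i * (M e j * c j))"
        by (simp add: algebra_simps sum_subtractf)
      also have "\<dots> = M e' i / M e i * s" by (simp add: s_def sum_distrib_left)
      finally show ?thesis by (simp add: sum)
    qed
    moreover have "\<exists>j\<in>I. d j \<noteq> 0" using c(1) by (auto simp: d_def I'_def)
    ultimately show ?thesis by blast
  qed
qed

lemma factorial_exceeds_exponential: "\<exists>N. a * b ^ N < (fact N :: nat)"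
proof -
  have "(\<lambda>n. inverse (fact n) * real b ^ n) \<longlonglongrightarrow> 0"
    by (rule summable_LIMSEQ_zero[OF summable_exp])
  then have "\<forall>\<^sub>F n in sequentially. inverse (fact n) * real b ^ n < inverse (real a + 1)"
    by (rule order_tendstoD) simp
  then obtain N where "inverse (fact N) * real b ^ N < inverse (real a + 1)"
    by (auto simp: eventually_sequentially)
  then have "(real a + 1) * real b ^ N < fact N"
    by (simp add: field_simps)
  then have "real (a * b ^ N) < real (fact N)"
    by (simp add: algebra_simps) (smt (verit) of_nat_0_le_iff zero_le_power)
  then show ?thesis by (intro exI[of _ N]) (simp only: of_nat_less_iff)
qed

lemma koszul_sign_cong:
  assumes "\<And>i. i \<in> set w \<Longrightarrow> p i = q i"
  shows "koszul_sign p w = koszul_sign q w"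
proof -
  have "{(i, j). i < j \<and> j < length w \<and> w ! j < w ! i \<and> p (w ! i) \<and> p (w ! j)} =
    {(i, j). i < j \<and> j < length w \<and> w ! j < w ! i \<and> q (w ! i) \<and> q (w ! j)}"
    using assms by auto
  then show ?thesis by (simp add: koszul_sign_def)
qed

text \<open>The letters 0 and 1 are reserved for the two variables at the beginning of every monomial of the
  identity; only the remaining \<open>N\<close> variables are permuted.\<close>

abbreviation arrangements :: "nat \<Rightarrow> nat list set" where
  "arrangements N \<equiv> permutations_of_set {2..<N + 2}"

text \<open>The conditions are indexed by a parity assignment, a substitution \<open>t\<close> of generators for the
  permuted variables and a target word \<open>u\<close>: with \<open>d\<close> generators these are
  \<open>2 ^ (N + 2) * d ^ N * d ^ N\<close> linear equations in \<open>fact N\<close> unknowns. A parity assignment matters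
  on the letters below \<open>N + 2\<close> only, which makes the number of equations finite.\<close>

lemma coefficients_exist:
  assumes "finite X"
  shows "\<exists>N (c :: nat list \<Rightarrow> 'f::field). (\<exists>w\<in>arrangements N. c w \<noteq> 0) \<and>
    (\<forall>p t u. t \<in> {2..<N + 2} \<rightarrow>\<^sub>E X \<and> set u \<subseteq> X \<and> length u = N \<longrightarrow>
      (\<Sum>w\<in>arrangements N. (if map t w = u then koszul_sign p (0 # 1 # w) * c w else 0)) = 0)"
proof -
  obtain N where N: "4 * (2 * card X * card X) ^ N < (fact N :: nat)"
    using factorial_exceeds_exponential by blast
  define E where "E = Pow {..<N + 2} \<times> ({2..<N + 2} \<rightarrow>\<^sub>E X) \<times> {u. set u \<subseteq> X \<and> length u = N}"
  define M :: "nat set \<times> (nat \<Rightarrow> 'a) \<times> 'a list \<Rightarrow> nat list \<Rightarrow> 'f" where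
    "M = (\<lambda>(q, t, u) w. if map t w = u then koszul_sign (\<lambda>i. i \<in> q) (0 # 1 # w) else 0)"
  have fin: "finite E"
    unfolding E_def using assms by (intro finite_cartesian_product finite_PiE finite_lists_length_eq) auto
  have "card E = 2 ^ (N + 2) * (card X ^ N * card X ^ N)"
    unfolding E_def using assms
    by (simp add: card_cartesian_product card_Pow card_PiE card_lists_length_eq)
  also have "\<dots> = 4 * (2 * card X * card X) ^ N"
    by (simp add: power_mult_distrib)
  also have "\<dots> < card (arrangements N)"
    using N by simp
  finally obtain c where c: "\<exists>w\<in>arrangements N. c w \<noteq> 0"
    "\<And>e. e \<in> E \<Longrightarrow> (\<Sum>w\<in>arrangements N. M e w * c w) = 0"
    using underdetermined_system_solution[OF fin, of "arrangements N" M] by auto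
  have "(\<Sum>w\<in>arrangements N. (if map t w = u then koszul_sign p (0 # 1 # w) * c w else 0)) = 0"
    if "t \<in> {2..<N + 2} \<rightarrow>\<^sub>E X" "set u \<subseteq> X" "length u = N" for p t u
  proof -
    define q where "q = {i. i < N + 2 \<and> p i}"
    have "koszul_sign p (0 # 1 # w) = (koszul_sign (\<lambda>i. i \<in> q) (0 # 1 # w) :: 'f)"
      if "w \<in> arrangements N" for w
      using permutations_of_setD(1)[OF that] by (intro koszul_sign_cong) (auto simp: q_def)
    then have "(\<Sum>w\<in>arrangements N. (if map t w = u then koszul_sign p (0 # 1 # w) * c w else 0)) =
      (\<Sum>w\<in>arrangements N. M (q, t, u) w * c w)"
      by (intro sum.cong) (auto simp: M_def)
    also have "\<dots> = 0"
      using that by (intro c(2)) (auto simp: E_def q_def)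
    finally show ?thesis .
  qed
  with c(1) show ?thesis by blast
qed

text \<open>Since the word \<open>w\<close> has distinct letters, exactly one substitution \<open>t\<close> turns it into \<open>u\<close>. The
  left side thereby becomes a combination of terms in which \<open>w\<close> enters only through the condition
  \<open>map t w = u\<close>.\<close>

lemma prod_list_eq_sum_substitutions:
  fixes g :: "nat \<Rightarrow> 'x \<Rightarrow> 'f::field"
  assumes "finite X" and w: "distinct w" and u: "set u \<subseteq> X" "length u = length w"
  shows "prod_list (map2 g w u) =
    (\<Sum>t\<in>set w \<rightarrow>\<^sub>E X. if map t w = u then (\<Prod>i\<in>set w. g i (t i)) else 0)"
proof -
  define t0 where "t0 = restrict (\<lambda>i. the (map_of (zip w u) i)) (set w)"
  have nth: "t0 (w ! k) = u ! k" if "k < length w" for k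
    using that w u by (simp add: t0_def map_of_zip_nth)
  have t0: "map t0 w = u"
    using u by (intro nth_equalityI) (simp_all add: nth)
  have mem: "t0 \<in> set w \<rightarrow>\<^sub>E X"
  proof (rule PiE_I)
    fix i assume "i \<in> set w"
    then show "t0 i \<in> X" using t0 u by auto
  qed (simp add: t0_def)
  have unique: "t = t0" if "t \<in> set w \<rightarrow>\<^sub>E X" "map t w = u" for t
  proof
    fix i
    have "\<forall>j\<in>set w. t j = t0 j" using that(2) t0 by (metis map_eq_conv)
    then show "t i = t0 i" using PiE_arb[OF that(1)] PiE_arb[OF mem] by (cases "i \<in> set w") auto
  qed
  have "map t w = u \<longleftrightarrow> t = t0" if "t \<in> set w \<rightarrow>\<^sub>E X" for t
    using unique[OF that] t0 by blast
  then have "(\<Sum>t\<in>set w \<rightarrow>\<^sub>E X. if map t w = u then (\<Prod>i\<in>set w. g i (t i)) else 0) =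
    (\<Sum>t\<in>set w \<rightarrow>\<^sub>E X. if t = t0 then (\<Prod>i\<in>set w. g i (t0 i)) else 0)"
    by (intro sum.cong) auto
  also have "\<dots> = (\<Prod>i\<in>set w. g i (t0 i))"
    using mem assms(1) by (simp add: finite_PiE)
  also have "\<dots> = prod_list (map (\<lambda>i. g i (t0 i)) w)"
    by (simp add: prod.distinct_set_conv_list[OF w])
  also have "map (\<lambda>i. g i (t0 i)) w = map2 g w u"
    using u by (intro nth_equalityI) (simp_all add: nth)
  finally show ?thesis by simp
qed

text \<open>Extends the cancellation from substitutions of generators to substitutions of linear combinations
  of generators, with \<open>g i x\<close> the coefficient of \<open>x\<close> in the value of the variable \<open>i\<close>: the product
  of these coefficients along \<open>w\<close> expands into substitutions of generators with weights that do not
  depend on \<open>w\<close>.\<close>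

lemma cancelling_coefficients:
  assumes "finite X"
  obtains N and c :: "nat list \<Rightarrow> 'f::field" where
    "\<exists>w\<in>arrangements N. c w \<noteq> 0"
    "\<And>p g u. set u \<subseteq> X \<Longrightarrow> length u = N \<Longrightarrow>
      (\<Sum>w\<in>arrangements N. koszul_sign p (0 # 1 # w) * c w * prod_list (map2 g w u)) = 0"
proof -
  obtain N and c :: "nat list \<Rightarrow> 'f" where c: "\<exists>w\<in>arrangements N. c w \<noteq> 0"
    "\<And>p t u. t \<in> {2..<N + 2} \<rightarrow>\<^sub>E X \<and> set u \<subseteq> X \<and> length u = N \<Longrightarrow>
      (\<Sum>w\<in>arrangements N. (if map t w = u then koszul_sign p (0 # 1 # w) * c w else 0)) = 0"
    using coefficients_exist[OF assms, where 'f = 'f] by blast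
  have "(\<Sum>w\<in>arrangements N. koszul_sign p (0 # 1 # w) * c w * prod_list (map2 g w u)) = 0"
    if u: "set u \<subseteq> X" "length u = N" for p g u
  proof -
    let ?T = "{2..<N + 2} \<rightarrow>\<^sub>E X"
    have "(\<Sum>w\<in>arrangements N. koszul_sign p (0 # 1 # w) * c w * prod_list (map2 g w u)) =
      (\<Sum>w\<in>arrangements N. \<Sum>t\<in>?T. (\<Prod>i\<in>{2..<N + 2}. g i (t i)) *
        (if map t w = u then koszul_sign p (0 # 1 # w) * c w else 0))"
    proof (intro sum.cong refl)
      fix w assume w: "w \<in> arrangements N"
      note w = permutations_of_setD[OF w] length_finite_permutations_of_set[OF w]
      have "prod_list (map2 g w u) =
          (\<Sum>t\<in>?T. if map t w = u then (\<Prod>i\<in>{2..<N + 2}. g i (t i)) else 0)"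
        using prod_list_eq_sum_substitutions[OF assms w(2) u(1), of g] u(2) w(3)
        unfolding w(1) by simp
      then show "koszul_sign p (0 # 1 # w) * c w * prod_list (map2 g w u) =
        (\<Sum>t\<in>?T. (\<Prod>i\<in>{2..<N + 2}. g i (t i)) *
          (if map t w = u then koszul_sign p (0 # 1 # w) * c w else 0))"
        by (simp add: sum_distrib_left) (intro sum.cong, auto simp: algebra_simps)
    qed
    also have "\<dots> = (\<Sum>t\<in>?T. (\<Prod>i\<in>{2..<N + 2}. g i (t i)) *
        (\<Sum>w\<in>arrangements N. if map t w = u then koszul_sign p (0 # 1 # w) * c w else 0))"
      by (subst sum.swap) (simp add: sum_distrib_left)
    also have "\<dots> = 0"
      using c(2) u by (intro sum.neutral) simp
    finally show ?thesis .
  qed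
  with c(1) show thesis by (rule that)
qed

section \<open>Left-normed polynomials\<close>

definition left_normed :: "'x monom \<Rightarrow> 'x list \<Rightarrow> 'x monom" where
  "left_normed = foldl (\<lambda>m x. Mul m (Gen x))"

lemma letters_left_normed: "letters (left_normed m xs) = letters m @ xs"
  unfolding left_normed_def by (induction xs arbitrary: m) simp_all

definition arrangement_monom :: "nat list \<Rightarrow> nat monom" where
  "arrangement_monom = left_normed (Mul (Gen 0) (Gen 1))"

lemma letters_arrangement_monom [simp]: "letters (arrangement_monom w) = 0 # 1 # w"
  by (simp add: arrangement_monom_def letters_left_normed)

lemma inj_arrangement_monom: "inj arrangement_monom"
  by (rule injI) (metis letters_arrangement_monom list.inject)

definition left_normed_poly :: "nat \<Rightarrow> (nat list \<Rightarrow> 'f::field) \<Rightarrow> (nat, 'f) npoly" where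
  "left_normed_poly N c = (\<Sum>w\<in>arrangements N. Poly_Mapping.single (arrangement_monom w) (c w))"

lemma lookup_left_normed_poly:
  assumes "w \<in> arrangements N"
  shows "Poly_Mapping.lookup (left_normed_poly N c) (arrangement_monom w) = c w"
proof -
  have "Poly_Mapping.lookup (left_normed_poly N c) (arrangement_monom w) =
    (\<Sum>v\<in>arrangements N. if v = w then c w else 0)"
    unfolding left_normed_poly_def lookup_sum lookup_single
    by (intro sum.cong) (auto simp: when_def dest: injD[OF inj_arrangement_monom])
  then show ?thesis using assms by simp
qed

lemma keys_left_normed_poly:
  "Poly_Mapping.keys (left_normed_poly N c) \<subseteq> arrangement_monom ` arrangements N"
  unfolding left_normed_poly_def using keys_sum by (fastforce split: if_splits)

lemma multilinear_left_normed_poly: "multilinear (left_normed_poly N c)"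
  unfolding multilinear_def
proof (intro exI ballI conjI)
  fix m assume "m \<in> Poly_Mapping.keys (left_normed_poly N c)"
  then obtain w where w: "w \<in> arrangements N" "m = arrangement_monom w"
    using keys_left_normed_poly by blast
  note wD = permutations_of_setD[OF w(1)]
  show "distinct (letters m)" using wD by (simp add: w(2))
  show "set (letters m) = insert 0 (insert 1 {2..<N + 2})" using wD by (simp add: w(2))
qed

lemma lookup_superization:
  "Poly_Mapping.lookup (superization p f) m = koszul_sign p (letters m) * Poly_Mapping.lookup f m"
  by (auto simp: superization_def lookup_mapp when_def in_keys_iff)

lemma eval_monom_in_carrier:
  assumes "nonassoc_algebra A" "\<And>i. a i \<in> carrier A"
  shows "eval_monom A a m \<in> carrier A"
  using assms by (induction m) (simp_all add: nonassoc_algebra.mult_closed)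

lemma eval_poly_free:
  fixes b :: "'x \<Rightarrow> (nat + nat, 'f::field) npoly"
  assumes b: "\<And>i. b i \<in> carrier (free_superalgebra r s)"
  shows "eval_poly (free_superalgebra r s) b f = (\<Sum>m\<in>Poly_Mapping.keys f.
    Poly_Mapping.map ((*) (Poly_Mapping.lookup f m)) (eval_monom (free_superalgebra r s) b m))"
proof -
  interpret superalgebra "free_superalgebra r s :: ('f, (nat + nat, 'f) npoly) superalg"
    by (rule superalgebra_free_superalgebra)
  have sum: "(\<Oplus>\<^bsub>free_superalgebra r s\<^esub>k\<in>K. g k) = (\<Sum>k\<in>K. g k)"
    if "finite K" "\<And>k. g k \<in> carrier (free_superalgebra r s)"
    for g :: "'x monom \<Rightarrow> (nat + nat, 'f) npoly" and K
    using that by (induction K) (simp_all add: M.finsum_insert free_superalgebra_simps(2,3))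
  have "eval_monom (free_superalgebra r s) b m \<in> carrier (free_superalgebra r s)" for m
    using b by (intro eval_monom_in_carrier nonassoc_algebra_axioms)
  then show ?thesis
    unfolding eval_poly_def by (simp add: sum) (simp add: free_superalgebra_simps(4))
qed

lemma eval_left_normed_poly:
  fixes b :: "nat \<Rightarrow> (nat + nat, 'f::field) npoly"
  assumes b: "\<And>i. b i \<in> carrier (free_superalgebra r s)"
  shows "eval_poly (free_superalgebra r s) b (superization p (left_normed_poly N c)) =
    (\<Sum>w\<in>arrangements N. Poly_Mapping.map ((*) (koszul_sign p (0 # 1 # w) * c w))
      (eval_monom (free_superalgebra r s) b (arrangement_monom w)))"
proof -
  let ?f = "superization p (left_normed_poly N c)"
  have "Poly_Mapping.keys ?f \<subseteq> arrangement_monom ` arrangements N"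
    using keys_left_normed_poly by (force simp: in_keys_iff lookup_superization)
  moreover have "Poly_Mapping.map ((*) (0::'f)) g = 0" for g :: "(nat + nat, 'f) npoly"
    by (rule poly_mapping_eqI) (simp add: lookup_smult)
  ultimately have "eval_poly (free_superalgebra r s) b ?f =
    (\<Sum>m\<in>arrangement_monom ` arrangements N.
      Poly_Mapping.map ((*) (Poly_Mapping.lookup ?f m)) (eval_monom (free_superalgebra r s) b m))"
    unfolding eval_poly_free[of b, OF b]
    by (intro sum.mono_neutral_left) (auto simp: in_keys_iff)
  also have "\<dots> = (\<Sum>w\<in>arrangements N. Poly_Mapping.map ((*) (koszul_sign p (0 # 1 # w) * c w))
      (eval_monom (free_superalgebra r s) b (arrangement_monom w)))"
    by (subst sum.reindex)
      (auto intro: inj_on_subset[OF inj_arrangement_monom] simp: lookup_superization lookup_left_normed_poly)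
  finally show ?thesis .
qed

section \<open>Left-normed products in the free superalgebra\<close>

definition linear_part :: "('x, 'f::zero) npoly \<Rightarrow> ('x, 'f) npoly" where
  "linear_part f = Poly_Mapping.mapp (\<lambda>m c. case m of Gen _ \<Rightarrow> c | Mul _ _ \<Rightarrow> 0) f"

lemma lookup_linear_part:
  "Poly_Mapping.lookup (linear_part f) m =
    (case m of Gen _ \<Rightarrow> Poly_Mapping.lookup f m | Mul _ _ \<Rightarrow> 0)"
  by (auto simp: linear_part_def lookup_mapp when_def in_keys_iff split: monom.splits)

text \<open>Peeling factors off a monomial \<open>m\<close> from the right determines which word \<open>u\<close> of generators the
  linear factors must contribute. The essential point is the order of quantifiers: \<open>v\<close> and \<open>u\<close>
  depend on \<open>m\<close> and on the length of \<open>w\<close>, but not on \<open>w\<close> itself, so that the coefficients for all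
  arrangements \<open>w\<close> can be summed.\<close>

lemma lookup_foldl_mult:
  fixes g :: "'i \<Rightarrow> (nat + nat, 'f::field) npoly" and r s
  defines "R \<equiv> \<lambda>h w. foldl (\<lambda>u i. u \<otimes>\<^bsub>free_superalgebra r s\<^esub> linear_part (g i)) h w"
  assumes g: "\<And>i. g i \<in> carrier (free_superalgebra r s)"
  shows "(\<forall>w. length w = N \<longrightarrow> Poly_Mapping.lookup (R h w) m = 0) \<or>
    (\<exists>v u. length u = N \<and> set u \<subseteq> generators r s \<and> (\<forall>w. length w = N \<longrightarrow>
      Poly_Mapping.lookup (R h w) m =
        Poly_Mapping.lookup h v * prod_list (map2 (\<lambda>i x. Poly_Mapping.lookup (g i) (Gen x)) w u)))"
proof (induction N arbitrary: m)
  case 0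
  show ?case by (rule disjI2, rule exI[of _ m], rule exI[of _ "[]"]) (simp add: R_def)
next
  case (Suc N)
  have snoc: "\<exists>w' i. w = w' @ [i] \<and> length w' = N" if "length w = Suc N" for w :: "'i list"
    using that by (cases w rule: rev_cases) auto
  have step: "R h (w @ [i]) = R h w \<otimes>\<^bsub>free_superalgebra r s\<^esub> linear_part (g i)" for w i
    by (simp add: R_def)
  consider (zero) "\<And>w i. Poly_Mapping.lookup (R h (w @ [i])) m = 0"
    | (last) m' x where "m = Mul m' (Gen x)" "x \<in> generators r s"
  proof (cases m)
    case (Mul m' v)
    show thesis
    proof (cases v)
      case (Gen x)
      show thesis
      proof (cases "x \<in> generators r s")
        case True
        with Gen Mul show thesis using last by simp
      next
        case False
        then have "Poly_Mapping.lookup (g i) (Gen x) = 0" for i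
          using g[of i] by (force simp: mem_free_iff)
        with Gen Mul show thesis
          using zero by (simp add: step lookup_free_mult lookup_linear_part)
      qed
    qed (use Mul zero in \<open>simp add: step lookup_free_mult lookup_linear_part\<close>)
  qed (use zero in \<open>simp add: step lookup_free_mult\<close>)
  then show ?case
  proof cases
    case zero
    then show ?thesis using snoc by blast
  next
    case (last m' x)
    then have lookup: "Poly_Mapping.lookup (R h (w @ [i])) m =
        Poly_Mapping.lookup (R h w) m' * Poly_Mapping.lookup (g i) (Gen x)" for w i
      by (simp add: step lookup_free_mult lookup_linear_part)
    from Suc.IH[of m'] show ?thesis
    proof (elim disjE exE conjE)
      assume "\<forall>w. length w = N \<longrightarrow> Poly_Mapping.lookup (R h w) m' = 0"
      then show ?thesis using snoc lookup by (metis mult_zero_left)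
    next
      fix v u
      assume u: "length u = N" "set u \<subseteq> generators r s" and
        IH: "\<forall>w. length w = N \<longrightarrow> Poly_Mapping.lookup (R h w) m' =
          Poly_Mapping.lookup h v * prod_list (map2 (\<lambda>i x. Poly_Mapping.lookup (g i) (Gen x)) w u)"
      have "Poly_Mapping.lookup (R h w) m = Poly_Mapping.lookup h v *
          prod_list (map2 (\<lambda>i x. Poly_Mapping.lookup (g i) (Gen x)) w (u @ [x]))"
        if "length w = Suc N" for w
        using snoc[OF that] lookup IH u(1) by (auto simp: mult.assoc)
      then show ?thesis using u last(2)
        by (intro disjI2 exI[of _ v] exI[of _ "u @ [x]"]) auto
    qed
  qed
qed

lemma eval_arrangement_monom:
  "eval_monom A b (arrangement_monom w) =
    foldl (\<lambda>u i. u \<otimes>\<^bsub>A\<^esub> b i) (b 0 \<otimes>\<^bsub>A\<^esub> b 1) w"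
proof -
  have "eval_monom A b (left_normed m w) = foldl (\<lambda>u i. u \<otimes>\<^bsub>A\<^esub> b i) (eval_monom A b m) w" for m
    unfolding left_normed_def by (induction w arbitrary: m) simp_all
  then show ?thesis by (simp add: arrangement_monom_def)
qed

section \<open>The identity holds in the free metabelian superalgebra\<close>

lemma linear_part_in_carrier:
  "f \<in> carrier (free_superalgebra r s) \<Longrightarrow> linear_part f \<in> carrier (free_superalgebra r s)"
  by (auto simp: mem_free_iff lookup_linear_part split: monom.splits)

text \<open>A polynomial without linear part is a combination of monomials that are products, and the product
  of two such monomials is a value of the metabelian monomial.\<close>

lemma square_mult_square:
  fixes f g :: "(nat + nat, 'f::field) npoly" and r s
  defines "F \<equiv> free_superalgebra r s"
  assumes sub: "submodule J base_field F"
    and met: "\<And>x y z t. \<lbrakk>x \<in> carrier F; y \<in> carrier F; z \<in> carrier F; t \<in> carrier F\<rbrakk> \<Longrightarrow>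
      (x \<otimes>\<^bsub>F\<^esub> y) \<otimes>\<^bsub>F\<^esub> (z \<otimes>\<^bsub>F\<^esub> t) \<in> J"
    and f: "f \<in> carrier F" "linear_part f = 0" and g: "g \<in> carrier F" "linear_part g = 0"
  shows "f \<otimes>\<^bsub>F\<^esub> g \<in> J"
proof -
  interpret superalgebra F
    unfolding F_def by (rule superalgebra_free_superalgebra)
  have add: "x + y \<in> J" if "x \<in> J" "y \<in> J" for x y
    using submoduleE(5)[OF sub that] by (simp add: F_def free_superalgebra_simps)
  have zero: "0 \<in> J"
    using subgroup.one_closed[OF submodule.axioms(1)[OF sub]]
    by (simp add: F_def free_superalgebra_simps)
  have sum: "(\<Sum>k\<in>K. q k) \<in> J" if "\<And>k. k \<in> K \<Longrightarrow> q k \<in> J"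
    for q :: "(nat + nat) monom \<Rightarrow> (nat + nat, 'f) npoly" and K
    using that by (induction K rule: infinite_finite_induct) (auto simp: zero add)
  have Mul: "\<exists>a b. m = Mul a b \<and> set (letters m) \<subseteq> generators r s"
    if "m \<in> Poly_Mapping.keys q" "q \<in> carrier F" "linear_part q = 0"
    for m and q :: "(nat + nat, 'f) npoly"
  proof (cases m)
    case (Gen x)
    then have "Poly_Mapping.lookup q m = Poly_Mapping.lookup (linear_part q) m"
      by (simp add: lookup_linear_part)
    with that show ?thesis by (simp add: in_keys_iff)
  next
    case Mul
    have "set (letters m) \<subseteq> generators r s"
      using that by (simp add: F_def free_superalgebra_simps)
    with Mul show ?thesis by simp
  qed
  have "Poly_Mapping.single (Mul u v) k \<in> J"
    if u: "u \<in> Poly_Mapping.keys f" and v: "v \<in> Poly_Mapping.keys g" for u v k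
  proof -
    obtain a b c d where ab: "u = Mul a b" "set (letters u) \<subseteq> generators r s"
      and cd: "v = Mul c d" "set (letters v) \<subseteq> generators r s"
      using Mul[OF u f] Mul[OF v g] by blast
    let ?s = "\<lambda>m k. Poly_Mapping.single m k :: (nat + nat, 'f) npoly"
    have "(?s a 1 \<otimes>\<^bsub>F\<^esub> ?s b 1) \<otimes>\<^bsub>F\<^esub> (?s c 1 \<otimes>\<^bsub>F\<^esub> ?s d k) \<in> J"
      using ab cd by (intro met) (auto simp: F_def free_superalgebra_simps)
    also have "(?s a 1 \<otimes>\<^bsub>F\<^esub> ?s b 1) \<otimes>\<^bsub>F\<^esub> (?s c 1 \<otimes>\<^bsub>F\<^esub> ?s d k) = ?s (Mul u v) k"
      unfolding F_def ab cd
      by (rule poly_mapping_eqI)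
        (auto simp: lookup_free_mult lookup_single when_def split: monom.splits)
    finally show ?thesis .
  qed
  then have "(\<Sum>u\<in>Poly_Mapping.keys f. \<Sum>v\<in>Poly_Mapping.keys g. Poly_Mapping.single (Mul u v)
      (Poly_Mapping.lookup f u * Poly_Mapping.lookup g v)) \<in> J"
    by (intro sum)
  then show ?thesis by (simp add: F_def free_superalgebra_def)
qed

text \<open>No partial product \<open>P\<close> of a left-normed monomial has a linear part, so modulo the ideal only the
  linear parts of the values of the permuted variables matter: \<open>P\<close> is congruent to the product \<open>L\<close>
  of the linear parts. After this replacement the sum over the arrangements is zero coefficient by
  coefficient.\<close>

lemma left_normed_poly_vanishes:
  fixes b :: "nat \<Rightarrow> (nat + nat, 'f::field) npoly" and r s
  defines "F \<equiv> free_superalgebra r s"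
  assumes ideal: "graded_ideal F J"
    and met: "\<And>x y z t. \<lbrakk>x \<in> carrier F; y \<in> carrier F; z \<in> carrier F; t \<in> carrier F\<rbrakk> \<Longrightarrow>
      (x \<otimes>\<^bsub>F\<^esub> y) \<otimes>\<^bsub>F\<^esub> (z \<otimes>\<^bsub>F\<^esub> t) \<in> J"
    and c: "\<And>g u. set u \<subseteq> generators r s \<Longrightarrow> length u = N \<Longrightarrow>
      (\<Sum>w\<in>arrangements N. koszul_sign p (0 # 1 # w) * c w * prod_list (map2 g w u)) = 0"
    and b: "\<And>i. b i \<in> carrier F"
  shows "eval_poly F b (superization p (left_normed_poly N c)) \<in> J"
proof -
  interpret superalgebra F
    unfolding F_def by (rule superalgebra_free_superalgebra)
  interpret graded_quotient F J
    using graded_quotient_free ideal unfolding F_def .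
  have add: "x \<oplus>\<^bsub>F\<^esub> y = x + y" for x y
    by (simp add: F_def free_superalgebra_simps)
  define h where "h = b 0 \<otimes>\<^bsub>F\<^esub> b 1"
  define P where "P = foldl (\<lambda>u i. u \<otimes>\<^bsub>F\<^esub> b i) h"
  define L where "L = foldl (\<lambda>u i. u \<otimes>\<^bsub>F\<^esub> linear_part (b i)) h"
  have lin: "linear_part (b i) \<in> carrier F" for i
    using b linear_part_in_carrier unfolding F_def by blast
  have lin_mult: "linear_part (x \<otimes>\<^bsub>F\<^esub> y) = 0" for x y
    by (rule poly_mapping_eqI) (simp add: F_def lookup_linear_part lookup_free_mult split: monom.splits)
  have P: "P w \<in> carrier F \<and> linear_part (P w) = 0" for w
  proof (induction w rule: rev_induct)
    case Nil
    then show ?case using b by (simp add: P_def h_def mult_closed lin_mult)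
  next
    case (snoc i w)
    then show ?case using b by (simp add: P_def mult_closed lin_mult)
  qed
  have zero: "0 \<in> J" using J.zero_closed by (simp add: F_def free_superalgebra_simps)
  have diff: "P w - L w \<in> J" for w
  proof (induction w rule: rev_induct)
    case Nil
    then show ?case by (simp add: P_def L_def zero)
  next
    case (snoc i w)
    let ?q = "b i - linear_part (b i)"
    have "Poly_Mapping.lookup (b i) m \<noteq> 0" if "Poly_Mapping.lookup ?q m \<noteq> 0" for m
      using that by (cases m) (simp_all add: lookup_minus lookup_linear_part)
    then have "?q \<in> carrier F"
      using b[of i] unfolding F_def mem_free_iff by simp
    moreover have "linear_part ?q = 0"
      by (rule poly_mapping_eqI) (simp add: lookup_linear_part lookup_minus split: monom.splits)
    ultimately have "P w \<otimes>\<^bsub>F\<^esub> ?q \<in> J"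
      using P[of w] square_mult_square[OF ideal_submodule[unfolded F_def] met[unfolded F_def]]
      unfolding F_def by simp
    moreover have "(P w - L w) \<otimes>\<^bsub>F\<^esub> linear_part (b i) \<in> J"
      by (rule ideal_mult(2)[OF lin snoc])
    moreover have "P (w @ [i]) - L (w @ [i]) =
        P w \<otimes>\<^bsub>F\<^esub> ?q + (P w - L w) \<otimes>\<^bsub>F\<^esub> linear_part (b i)"
      by (rule poly_mapping_eqI)
        (simp add: P_def L_def F_def lookup_free_mult lookup_minus lookup_add algebra_simps
          split: monom.splits)
    ultimately show ?case using ideal_add unfolding add by simp
  qed
  define k where "k w = koszul_sign p (0 # 1 # w) * c w" for w
  have "(\<Sum>w\<in>arrangements N. Poly_Mapping.map ((*) (k w)) (L w)) = 0"
  proof (rule poly_mapping_eqI)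
    fix m
    have "(\<Sum>w\<in>arrangements N. k w * Poly_Mapping.lookup (L w) m) = 0"
    proof -
      have len: "length w = N" if "w \<in> arrangements N" for w
        using length_finite_permutations_of_set[OF that] by simp
      let ?g = "\<lambda>i x. Poly_Mapping.lookup (b i) (Gen x)"
      have "(\<forall>w. length w = N \<longrightarrow> Poly_Mapping.lookup (L w) m = 0) \<or>
        (\<exists>v u. length u = N \<and> set u \<subseteq> generators r s \<and> (\<forall>w. length w = N \<longrightarrow>
          Poly_Mapping.lookup (L w) m = Poly_Mapping.lookup h v * prod_list (map2 ?g w u)))"
        unfolding L_def F_def by (rule lookup_foldl_mult[of b r s N h m, OF b[unfolded F_def]])
      then show ?thesis
      proof (elim disjE exE conjE)
        assume "\<forall>w. length w = N \<longrightarrow> Poly_Mapping.lookup (L w) m = 0"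
        then show ?thesis using len by (intro sum.neutral) simp
      next
        fix v u
        assume u: "length u = N" "set u \<subseteq> generators r s"
          and eq: "\<forall>w. length w = N \<longrightarrow>
            Poly_Mapping.lookup (L w) m = Poly_Mapping.lookup h v * prod_list (map2 ?g w u)"
        have "(\<Sum>w\<in>arrangements N. k w * Poly_Mapping.lookup (L w) m) =
          (\<Sum>w\<in>arrangements N. Poly_Mapping.lookup h v * (k w * prod_list (map2 ?g w u)))"
          using eq len by (intro sum.cong) (simp_all add: mult_ac)
        also have "\<dots> = Poly_Mapping.lookup h v * (\<Sum>w\<in>arrangements N. k w * prod_list (map2 ?g w u))"
          by (simp add: sum_distrib_left)
        also have "\<dots> = 0" unfolding k_def using c[OF u(2,1)] by simp
        finally show ?thesis .
      qed
    qed
    then show "Poly_Mapping.lookup (\<Sum>w\<in>arrangements N. Poly_Mapping.map ((*) (k w)) (L w)) m =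
        Poly_Mapping.lookup 0 m"
      by (simp add: lookup_sum lookup_smult)
  qed
  moreover have "(\<Sum>w\<in>arrangements N. Poly_Mapping.map ((*) (k w)) (P w)) =
      (\<Sum>w\<in>arrangements N. Poly_Mapping.map ((*) (k w)) (P w - L w)) +
      (\<Sum>w\<in>arrangements N. Poly_Mapping.map ((*) (k w)) (L w))"
    unfolding sum.distrib[symmetric]
    by (intro sum.cong refl poly_mapping_eqI) (simp add: lookup_add lookup_smult lookup_minus algebra_simps)
  moreover have "(\<Sum>w\<in>W. Poly_Mapping.map ((*) (k w)) (P w - L w)) \<in> J" for W
  proof (induction W rule: infinite_finite_induct)
    case (insert w W)
    have "Poly_Mapping.map ((*) (k w)) (P w - L w) \<in> J"
      using ideal_smult[OF diff] by (simp add: F_def free_superalgebra_simps)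
    then show ?case using insert ideal_add unfolding add by simp
  qed (simp_all add: zero)
  ultimately have "(\<Sum>w\<in>arrangements N. Poly_Mapping.map ((*) (k w)) (P w)) \<in> J" by simp
  then show ?thesis
    unfolding F_def using eval_left_normed_poly[of b, OF b[unfolded F_def]]
    by (simp add: k_def P_def h_def F_def eval_arrangement_monom)
qed

lemma free_metabelian_superalgebra_satisfies:
  fixes c :: "nat list \<Rightarrow> 'f::field"
  assumes c: "\<And>p g u. set u \<subseteq> generators r s \<Longrightarrow> length u = N \<Longrightarrow>
      (\<Sum>w\<in>arrangements N. koszul_sign p (0 # 1 # w) * c w * prod_list (map2 g w u)) = 0"
  shows "satisfies_super (free_V_superalgebra metabelian r s) (left_normed_poly N c)"
  unfolding satisfies_super_def
proof (intro allI impI)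
  let ?F = "free_superalgebra r s :: ('f, (nat + nat, 'f) npoly) superalg"
  let ?J = "free_super_ideal metabelian r s :: (nat + nat, 'f) npoly set"
  interpret graded_quotient ?F ?J
    by (intro graded_quotient_free free_super_ideal_metabelian(1))
  fix p :: "nat \<Rightarrow> bool" and a :: "nat \<Rightarrow> (nat + nat, 'f) npoly set"
  assume a: "\<forall>i. a i \<in> part (free_V_superalgebra metabelian r s :: ('f, (nat + nat, 'f) npoly set) superalg) (p i)"
  have "\<exists>b. b \<in> part ?F (p i) \<and> a i = ?J +>\<^bsub>?F\<^esub> b" for i
    using a[rule_format, of i] unfolding free_V_superalgebra_def quotient_simps by blast
  then obtain b where b: "\<And>i. b i \<in> part ?F (p i)" and ab: "\<And>i. a i = ?J +>\<^bsub>?F\<^esub> b i"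
    by metis
  have car: "b i \<in> carrier ?F" for i using b part_subset by blast
  let ?f = "superization p (left_normed_poly N c)"
  have a_eq: "a = (\<lambda>i. ?J +>\<^bsub>?F\<^esub> b i)" using ab by (rule ext)
  have "eval_poly Q a ?f = ?J +>\<^bsub>?F\<^esub> eval_poly ?F b ?f"
    unfolding a_eq by (rule hom_eval_poly[OF nonassoc_algebra_quotient car])
  also have "\<dots> = \<zero>\<^bsub>Q\<^esub>"
  proof -
    have "eval_poly ?F b ?f \<in> ?J"
      by (rule left_normed_poly_vanishes[OF free_super_ideal_metabelian c car])
    then show ?thesis using ideal_subset coset_eq_ideal_iff by (auto simp: quotient_simps)
  qed
  finally show "eval_poly (free_V_superalgebra metabelian r s) a ?f =
      \<zero>\<^bsub>free_V_superalgebra metabelian r s\<^esub>"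
    by (simp add: free_V_superalgebra_def)
qed

section \<open>The identity fails in a larger metabelian superalgebra\<close>

fun is_left_normed :: "'x monom \<Rightarrow> bool" where
  "is_left_normed (Gen x) = True"
| "is_left_normed (Mul u (Gen x)) = is_left_normed u"
| "is_left_normed (Mul u (Mul v w)) = False"

text \<open>Modulo the polynomials without left-normed monomials, a product vanishes whenever its right
  factor is itself a product. The quotient is therefore metabelian, while left-normed monomials
  remain linearly independent.\<close>

definition non_left_normed_ideal :: "nat \<Rightarrow> (nat + nat, 'f::field) npoly set" where
  "non_left_normed_ideal r = {f \<in> carrier (free_superalgebra r 0).
    \<forall>m. is_left_normed m \<longrightarrow> Poly_Mapping.lookup f m = 0}"

lemma non_left_normed_idealI:
  assumes "f \<in> carrier (free_superalgebra r 0)"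
    and "\<And>m. is_left_normed m \<Longrightarrow> Poly_Mapping.lookup f m = 0"
  shows "f \<in> non_left_normed_ideal r"
  using assms by (simp add: non_left_normed_ideal_def)

lemma lookup_non_left_normed_ideal:
  assumes "f \<in> non_left_normed_ideal r" "is_left_normed m"
  shows "Poly_Mapping.lookup f m = 0"
  using assms by (simp add: non_left_normed_ideal_def)

lemma is_left_normed_Mul:
  assumes "is_left_normed (Mul u v)"
  shows "is_left_normed u" "is_left_normed v"
  using assms by (cases v; simp)+

lemma graded_ideal_non_left_normed:
  "graded_ideal (free_superalgebra r 0) (non_left_normed_ideal r :: (nat + nat, 'f::field) npoly set)"
proof -
  let ?F = "free_superalgebra r 0 :: ('f, (nat + nat, 'f) npoly) superalg"
  let ?J = "non_left_normed_ideal r :: (nat + nat, 'f) npoly set"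
  interpret superalgebra ?F by (rule superalgebra_free_superalgebra)
  note S = free_superalgebra_simps(2-4)
  have car: "f \<in> carrier ?F" if "f \<in> ?J" for f using that by (simp add: non_left_normed_ideal_def)
  have "submodule ?J base_field ?F"
  proof (rule submoduleI)
    fix a assume a: "a \<in> ?J"
    have "\<ominus>\<^bsub>?F\<^esub> a = - a"
      using car[OF a] by (intro minus_equality) (auto simp: S mem_free_iff)
    moreover have "\<ominus>\<^bsub>?F\<^esub> a \<in> carrier ?F" using car[OF a] by simp
    ultimately show "\<ominus>\<^bsub>?F\<^esub> a \<in> ?J" using a by (simp add: non_left_normed_ideal_def)
  next
    fix a b assume ab: "a \<in> ?J" "b \<in> ?J"
    have "a \<oplus>\<^bsub>?F\<^esub> b \<in> carrier ?F" using ab car by simp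
    then show "a \<oplus>\<^bsub>?F\<^esub> b \<in> ?J"
      using ab by (simp add: non_left_normed_ideal_def S lookup_add)
  next
    fix c x assume x: "x \<in> ?J"
    have "c \<odot>\<^bsub>?F\<^esub> x \<in> carrier ?F" using car[OF x] by simp
    then show "c \<odot>\<^bsub>?F\<^esub> x \<in> ?J"
      using x by (simp add: non_left_normed_ideal_def S lookup_smult)
  next
    have "\<zero>\<^bsub>?F\<^esub> \<in> carrier ?F" by simp
    then show "\<zero>\<^bsub>?F\<^esub> \<in> ?J" by (simp add: non_left_normed_ideal_def S)
  qed (use car in blast)
  moreover have "a \<otimes>\<^bsub>?F\<^esub> x \<in> ?J \<and> x \<otimes>\<^bsub>?F\<^esub> a \<in> ?J" if "a \<in> carrier ?F" "x \<in> ?J" for a x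
  proof -
    have "a \<otimes>\<^bsub>?F\<^esub> x \<in> carrier ?F" "x \<otimes>\<^bsub>?F\<^esub> a \<in> carrier ?F"
      using that car mult_closed by auto
    then show ?thesis
      using that by (auto simp: non_left_normed_ideal_def lookup_free_mult
          dest: is_left_normed_Mul split: monom.splits)
  qed
  moreover have "\<exists>y\<in>?J \<inter> part ?F False. \<exists>z\<in>?J \<inter> part ?F True. x = y \<oplus>\<^bsub>?F\<^esub> z" if x: "x \<in> ?J" for x
  proof -
    have "homogeneous_part i x \<in> ?J \<inter> part ?F i" for i
      using x homogeneous_part_in_part[OF car[OF x], of i] part_subset
      by (auto simp: non_left_normed_ideal_def lookup_homogeneous_part)
    then show ?thesis using homogeneous_part_sum[of x] unfolding S by blast
  qed
  ultimately show ?thesis unfolding graded_ideal_def by blast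
qed

abbreviation left_normed_superalgebra :: "nat \<Rightarrow> ('f::field, 'f universe) superalg" where
  "left_normed_superalgebra r \<equiv>
    quotient_superalgebra (free_superalgebra r 0) (non_left_normed_ideal r)"

lemma graded_quotient_left_normed:
  "graded_quotient (free_superalgebra r 0) (non_left_normed_ideal r)"
  by (intro graded_quotient_free graded_ideal_non_left_normed)

lemma left_normed_superalgebra_metabelian:
  "(left_normed_superalgebra r :: ('f::field, 'f universe) superalg) \<in> super_class metabelian"
proof -
  let ?F = "free_superalgebra r 0 :: ('f, (nat + nat, 'f) npoly) superalg"
  interpret graded_quotient ?F "non_left_normed_ideal r"
    by (rule graded_quotient_left_normed)
  have "Poly_Mapping.lookup ((x \<otimes>\<^bsub>?F\<^esub> y) \<otimes>\<^bsub>?F\<^esub> (z \<otimes>\<^bsub>?F\<^esub> t)) m = 0" if "is_left_normed m" for x y z t m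
    using that by (cases m rule: is_left_normed.cases) (simp_all add: lookup_free_mult)
  then show ?thesis
    by (intro quotient_metabelian_iff[THEN iffD2] ballI non_left_normed_idealI mult_closed)
qed

lemma eval_monom_generators:
  assumes "\<And>i. i \<in> set (letters m) \<Longrightarrow> b i = Poly_Mapping.single (Gen (\<phi> i)) 1"
  shows "eval_monom (free_superalgebra r s) b m =
    (Poly_Mapping.single (map_monom \<phi> m) 1 :: (nat + nat, 'f::field) npoly)"
  using assms
proof (induction m)
  case (Mul u v)
  then have "eval_monom (free_superalgebra r s) b (Mul u v) =
    Poly_Mapping.single (map_monom \<phi> u) 1 \<otimes>\<^bsub>free_superalgebra r s\<^esub>
      (Poly_Mapping.single (map_monom \<phi> v) 1 :: (nat + nat, 'f) npoly)"
    by simp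
  also have "\<dots> = Poly_Mapping.single (map_monom \<phi> (Mul u v)) 1"
    by (rule poly_mapping_eqI) (auto simp: lookup_free_mult lookup_single when_def split: monom.splits)
  finally show ?case .
qed simp

lemma is_left_normed_arrangement:
  fixes \<phi> :: "nat \<Rightarrow> 'x"
  shows "is_left_normed (map_monom \<phi> (arrangement_monom w))"
proof -
  have "map_monom \<phi> (left_normed m w) = left_normed (map_monom \<phi> m) (map \<phi> w)" for m
    unfolding left_normed_def by (induction w arbitrary: m) simp_all
  moreover have "is_left_normed (left_normed m xs)" if "is_left_normed m" for m :: "'x monom" and xs
    using that unfolding left_normed_def by (induction xs arbitrary: m) simp_all
  ultimately show ?thesis by (simp add: arrangement_monom_def)
qed

text \<open>Substitute distinct even generators for the variables: no signs arise, and the monomials of the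
  polynomial become different left-normed monomials, so no cancellation is possible.\<close>

lemma left_normed_superalgebra_violates:
  fixes c :: "nat list \<Rightarrow> 'f::field"
  assumes w: "w \<in> arrangements N" "c w \<noteq> 0"
  shows "\<not> satisfies_super (left_normed_superalgebra (N + 2)) (left_normed_poly N c)"
proof
  assume sat: "satisfies_super (left_normed_superalgebra (N + 2)) (left_normed_poly N c)"
  let ?F = "free_superalgebra (N + 2) 0 :: ('f, (nat + nat, 'f) npoly) superalg"
  let ?J = "non_left_normed_ideal (N + 2) :: (nat + nat, 'f) npoly set"
  interpret graded_quotient ?F ?J by (rule graded_quotient_left_normed)
  define b :: "nat \<Rightarrow> (nat + nat, 'f) npoly" where
    "b i = (if i < N + 2 then Poly_Mapping.single (Gen (Inl i)) 1 else 0)" for i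
  have part: "b i \<in> part ?F False" for i
    by (auto simp: b_def free_superalgebra_simps generators_def monom_parity_def)
  then have car: "b i \<in> carrier ?F" for i using part_subset by blast
  define p where "p = (\<lambda>_::nat. False)"
  let ?f = "superization p (left_normed_poly N c)"
  have "eval_poly Q (\<lambda>i. ?J +>\<^bsub>?F\<^esub> b i) ?f = \<zero>\<^bsub>Q\<^esub>"
    by (rule sat[unfolded satisfies_super_def, rule_format])
      (unfold quotient_simps p_def, intro imageI part)
  then have J: "?J +>\<^bsub>?F\<^esub> eval_poly ?F b ?f = ?J"
    unfolding hom_eval_poly[OF nonassoc_algebra_quotient car] quotient_simps(2) .
  have eval: "eval_poly ?F b ?f =
    (\<Sum>v\<in>arrangements N. Poly_Mapping.single (map_monom Inl (arrangement_monom v)) (c v))"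
  proof -
    have one: "koszul_sign p xs = (1::'f)" for xs by (simp add: koszul_sign_def p_def)
    have "eval_monom ?F b (arrangement_monom v) =
        Poly_Mapping.single (map_monom Inl (arrangement_monom v)) 1" if "v \<in> arrangements N" for v
      using permutations_of_setD(1)[OF that] by (intro eval_monom_generators) (auto simp: b_def)
    then show ?thesis
      unfolding eval_left_normed_poly[of b, OF car]
      by (intro sum.cong refl poly_mapping_eqI)
        (simp add: one lookup_smult lookup_single when_def)
  qed
  have "eval_poly ?F b ?f \<in> carrier ?F"
    unfolding eval mem_free_iff
  proof (intro allI impI)
    fix m :: "(nat + nat) monom"
    assume "Poly_Mapping.lookup (\<Sum>v\<in>arrangements N.
      Poly_Mapping.single (map_monom Inl (arrangement_monom v)) (c v)) m \<noteq> 0"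
    then obtain v where v: "v \<in> arrangements N" "m = map_monom Inl (arrangement_monom v)"
      unfolding lookup_sum
      by (elim sum.not_neutral_contains_not_neutral) (auto simp: lookup_single when_def split: if_splits)
    have "letters (map_monom \<phi> n) = map \<phi> (letters n)" for \<phi> :: "nat \<Rightarrow> nat + nat" and n
      by (induction n) simp_all
    then show "set (letters m) \<subseteq> generators (N + 2) 0"
      using permutations_of_setD(1)[OF v(1)] by (auto simp: v(2) generators_def)
  qed
  then have "eval_poly ?F b ?f \<in> ?J" using J coset_eq_ideal_iff by simp
  then have "Poly_Mapping.lookup (eval_poly ?F b ?f) (map_monom Inl (arrangement_monom w)) = 0"
    by (rule lookup_non_left_normed_ideal[OF _ is_left_normed_arrangement])
  moreover have "Poly_Mapping.lookup (eval_poly ?F b ?f) (map_monom Inl (arrangement_monom w)) = c w"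
  proof -
    have inj: "inj (\<lambda>v. map_monom (Inl :: nat \<Rightarrow> nat + nat) (arrangement_monom v))"
      using inj_compose[OF monom.inj_map[OF inj_Inl] inj_arrangement_monom] by (simp add: comp_def)
    have "Poly_Mapping.lookup (eval_poly ?F b ?f) (map_monom Inl (arrangement_monom w)) =
        (\<Sum>v\<in>arrangements N. if v = w then c w else 0)"
      unfolding eval lookup_sum lookup_single
      by (intro sum.cong) (auto simp: when_def dest: injD[OF inj])
    then show ?thesis using w by simp
  qed
  ultimately show False using w by simp
qed

lemma left_normed_superalgebra_nontrivial:
  "carrier (left_normed_superalgebra 1 :: ('f::field, 'f universe) superalg) \<noteq> {\<zero>\<^bsub>left_normed_superalgebra 1\<^esub>}"
proof -
  let ?F = "free_superalgebra 1 0 :: ('f, (nat + nat, 'f) npoly) superalg"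
  interpret graded_quotient ?F "non_left_normed_ideal 1" by (rule graded_quotient_left_normed)
  let ?x = "Poly_Mapping.single (Gen (Inl 0)) 1 :: (nat + nat, 'f) npoly"
  have x: "?x \<in> carrier ?F" by (simp add: free_superalgebra_simps generators_def)
  show ?thesis
  proof
    assume trivial: "carrier Q = {\<zero>\<^bsub>Q\<^esub>}"
    have "non_left_normed_ideal 1 +>\<^bsub>?F\<^esub> ?x = non_left_normed_ideal 1"
      using hom_mem[OF x] unfolding trivial quotient_simps(2) by (rule singletonD)
    then have "?x \<in> non_left_normed_ideal 1"
      using coset_eq_ideal_iff[OF x] by simp
    then have "Poly_Mapping.lookup ?x (Gen (Inl 0)) = 0"
      by (rule lookup_non_left_normed_ideal) simp
    then show False by simp
  qed
qed

theorem corollary5p1: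
  shows "\<forall>r s. (supervariety_rs metabelian r s :: ('f::field_char_0, 'f universe) superalg set)
    \<noteq> super_class metabelian"
proof (intro allI notI)
  fix r s
  assume eq: "(supervariety_rs metabelian r s :: ('f, 'f universe) superalg set) = super_class metabelian"
  then have mem: "(left_normed_superalgebra n :: ('f, 'f universe) superalg) \<in> supervariety_rs metabelian r s" for n
    using left_normed_superalgebra_metabelian by simp
  show False
  proof (cases "r = 0 \<and> s = 0")
    case True
    then show False
      using mem[of 1] left_normed_superalgebra_nontrivial[where 'f = 'f] by (simp add: supervariety_rs_def)
  next
    case False
    have "finite (generators r s)" by (simp add: generators_def)
    then obtain N and c :: "nat list \<Rightarrow> 'f" where c: "\<exists>w\<in>arrangements N. c w \<noteq> 0"
      "\<And>p g u. set u \<subseteq> generators r s \<Longrightarrow> length u = N \<Longrightarrow>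
        (\<Sum>w\<in>arrangements N. koszul_sign p (0 # 1 # w) * c w * prod_list (map2 g w u)) = 0"
      by (rule cancelling_coefficients) blast
    have "satisfies_super (free_V_superalgebra metabelian r s) (left_normed_poly N c)"
      by (rule free_metabelian_superalgebra_satisfies) (rule c(2))
    then have "satisfies_super (left_normed_superalgebra (N + 2)) (left_normed_poly N c)"
      using mem[of "N + 2"] False multilinear_left_normed_poly[of N c]
      unfolding supervariety_rs_def generated_supervariety_def by simp
    then show False
      using c(1) left_normed_superalgebra_violates by blast
  qed
qed

end
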